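(* Let $\Bbbk$ be a field of characteristic zero, let $(V,\circ)$ be a finite-dimensional Novikov superalgebra over $\Bbbk$, and let $V$ be considered as a GD-superalgebra with respect to $\circ$ and the commutator $[a,b]=a\circ b-(-1)^{|a||b|}b\circ a$ (for homogeneous $a,b\in V$). Then the corresponding quadratic Lie conformal superalgebra $L(V)$ has a finite faithful representation.
   Context: All spaces are over $\Bbbk$; $H=\Bbbk[\partial]$ is the polynomial algebra in one variable; $|a|\in\{0,1\}$ is the parity of a homogeneous element $a$; all operations respect the $\mathbb Z_2$-grading. A Novikov superalgebra is a $\mathbb Z_2$-graded space $V=V_0\oplus V_1$ with a bilinear grading-respecting product $\circ$ such that for all homogeneous $a,b,c$: $(a\circ b)\circ c-a\circ(b\circ c)=(-1)^{|a||b|}\big((b\circ a)\circ c-b\circ(a\circ c)\big)$ and $(a\circ b)\circ c=(-1)^{|b||c|}(a\circ c)\circ b$. A GD-superalgebra (Gelfand--Dorfman superalgebra) is a $\mathbb Z_2$-graded space $V$ with bilinear grading-respecting operations $(\cdot\circ\cdot)$, $[\cdot,\cdot]$ such that $(V,\circ)$ is a Novikov superalgebra, $(V,[\cdot,\cdot])$ is a Lie superalgebra, and for all homogeneous $a,b,c\in V$ $$[a\circ b,c]-a\circ[b,c]+[a,b]\circ c+(-1)^{|a||b|}[b,a\circ c]-(-1)^{|b||c|}[a,c]\circ b=0.$$ It is known that every Novikov superalgebra is a GD-superalgebra with respect to its (super-)commutator. A Lie conformal superalgebra is a $\mathbb Z_2$-graded $H$-module $C=C_0\oplus C_1$ with a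 linear map $[\cdot\,{}_{(\lambda)}\,\cdot]:C\otimes C\to C[\lambda]$ such that $[C_i\,{}_{(\lambda)}\,C_j]\subseteq C_{(i+j)\bmod 2}[\lambda]$ and, for homogeneous $x,y,z\in C$: (sesqui-linearity) $[\partial x\,{}_{(\lambda)}\,y]=-\lambda[x\,{}_{(\lambda)}\,y]$, $[x\,{}_{(\lambda)}\,\partial y]=(\partial+\lambda)[x\,{}_{(\lambda)}\,y]$; $[x\,{}_{(\lambda)}\,y]=-(-1)^{|x||y|}[y\,{}_{(-\partial-\lambda)}\,x]$; $[x\,{}_{(\lambda)}\,[y\,{}_{(\mu)}\,z]]-(-1)^{|x||y|}[y\,{}_{(\mu)}\,[x\,{}_{(\lambda)}\,z]]=[[x\,{}_{(\lambda)}\,y]\,{}_{(\lambda+\mu)}\,z]$. Here if $[y\,{}_{(\lambda)}\,x]=\sum_n\lambda^nc_n$ then $[y\,{}_{(-\partial-\lambda)}\,x]=\sum_n(-\partial-\lambda)^nc_n$. For a GD-superalgebra $V$, the quadratic Lie conformal superalgebra $L(V)$ is the free $H$-module $H\otimes V$ with the $\lambda$-bracket determined by sesqui-linearity and $$[a\,{}_{(\lambda)}\,b]=[a,b]+(-1)^{|a||b|}(\partial+\lambda)(b\circ a)+\lambda(a\circ b)$$ for homogeneous $a,b\in V$. A representation of a Lie conformal superalgebra $L$ on a $\mathbb Z_2$-graded $H$-module $M=M_0\oplus M_1$ is a linear map $\rho_\lambda(\cdot,\cdot):L\otimes M\to M[\lambda]$ which respects the gradings, is sesqui-linear ($\rho_\lambda(\partial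 a,x)=-\lambda\rho_\lambda(a,x)$, $\rho_\lambda(a,\partial x)=(\partial+\lambda)\rho_\lambda(a,x)$), and satisfies $\rho_\lambda(a,\rho_\mu(b,x))-(-1)^{|a||b|}\rho_\mu(b,\rho_\lambda(a,x))=\rho_{\lambda+\mu}([a\,{}_{(\lambda)}\,b],x)$ for homogeneous $a,b\in L$ and $x\in M$. A finite representation is a representation on a free $H$-module $M=H\otimes U$, $M_i=H\otimes U_i$, with $U=U_0\oplus U_1$ a finite-dimensional $\mathbb Z_2$-graded space (equivalently, a homomorphism $L\to\mathrm{gc}_{n|m}$ with $n=\dim U_0$, $m=\dim U_1$). It is faithful if $\rho_\lambda(a,\cdot)=0$ implies $a=0$ for $a\in L$. *)

theory Defs
  imports
    Complex_Main
    "HOL-Computational_Algebra.Polynomial"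
    "HOL-Library.Z2"
    "HOL-Library.Function_Algebras"
begin

section \<open>Superspaces\<close>

text \<open>
  A family \<open>V :: bit \<Rightarrow> 'v set\<close> of subspaces (\<open>V 0\<close> even, \<open>V 1\<close> odd) of an ambient vector
  space is a superspace if the sum \<open>V 0 + V 1\<close> is direct.  The type \<open>bit\<close> is the field with two
  elements, so that \<open>i + j\<close> is the sum of parities mod 2 and \<open>i * j = 1\<close> iff both are odd.
\<close>

definition graded_sum :: "(bit \<Rightarrow> 'v::ab_group_add set) \<Rightarrow> 'v set" where
  "graded_sum V = {a + b | a b. a \<in> V 0 \<and> b \<in> V 1}"

locale superspace = vector_space scale
  for scale :: "'k::field \<Rightarrow> 'v::ab_group_add \<Rightarrow> 'v" +
  fixes V :: "bit \<Rightarrow> 'v set"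
  assumes subspace_part: "subspace (V i)"
    and direct: "V 0 \<inter> V 1 = {0}"
begin

definition fin_dim :: bool where
  "fin_dim \<longleftrightarrow> (\<exists>B. finite B \<and> span B = graded_sum V)"

end

text \<open>\<open>koszul i j x\<close> is \<open>(-1)\<^sup>i\<^sup>j x\<close>.\<close>

definition koszul :: "bit \<Rightarrow> bit \<Rightarrow> 'v::ab_group_add \<Rightarrow> 'v" where
  "koszul i j x = (if i * j = 1 then - x else x)"

text \<open>The homogeneous component of parity \<open>i\<close> of an element of \<open>graded_sum V\<close>.\<close>

definition component :: "(bit \<Rightarrow> 'v::ab_group_add set) \<Rightarrow> bit \<Rightarrow> 'v \<Rightarrow> 'v" where
  "component V i x = (THE a. a \<in> V i \<and> x - a \<in> V (i + 1))"

definition even_bilinear ::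
  "('k \<Rightarrow> 'x::ab_group_add \<Rightarrow> 'x) \<Rightarrow> (bit \<Rightarrow> 'x set) \<Rightarrow>
   ('k \<Rightarrow> 'y::ab_group_add \<Rightarrow> 'y) \<Rightarrow> (bit \<Rightarrow> 'y set) \<Rightarrow>
   ('k \<Rightarrow> 'z::ab_group_add \<Rightarrow> 'z) \<Rightarrow> (bit \<Rightarrow> 'z set) \<Rightarrow> ('x \<Rightarrow> 'y \<Rightarrow> 'z) \<Rightarrow> bool" where
  "even_bilinear sX X sY Y sZ Z f \<longleftrightarrow>
     (\<forall>x\<in>graded_sum X. \<forall>x'\<in>graded_sum X. \<forall>y\<in>graded_sum Y. f (x + x') y = f x y + f x' y) \<and>
     (\<forall>x\<in>graded_sum X. \<forall>y\<in>graded_sum Y. \<forall>y'\<in>graded_sum Y. f x (y + y') = f x y + f x y') \<and>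
     (\<forall>c. \<forall>x\<in>graded_sum X. \<forall>y\<in>graded_sum Y. f (sX c x) y = sZ c (f x y)) \<and>
     (\<forall>c. \<forall>x\<in>graded_sum X. \<forall>y\<in>graded_sum Y. f x (sY c y) = sZ c (f x y)) \<and>
     (\<forall>i j. \<forall>x\<in>X i. \<forall>y\<in>Y j. f x y \<in> Z (i + j))"


section \<open>Novikov, Lie and Gelfand--Dorfman superalgebras\<close>

locale novikov_superalgebra = superspace scale V
  for scale :: "'k::field \<Rightarrow> 'v::ab_group_add \<Rightarrow> 'v" and V +
  fixes circ :: "'v \<Rightarrow> 'v \<Rightarrow> 'v"  (infixl \<open>\<bullet>\<close> 70)
  assumes circ_bilinear: "even_bilinear scale V scale V scale V circ"
    and left_symmetric: "\<lbrakk>a \<in> V i; b \<in> V j; c \<in> V k\<rbrakk> \<Longrightarrow>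
      (a \<bullet> b) \<bullet> c - a \<bullet> (b \<bullet> c) = koszul i j ((b \<bullet> a) \<bullet> c - b \<bullet> (a \<bullet> c))"
    and right_commutative: "\<lbrakk>a \<in> V i; b \<in> V j; c \<in> V k\<rbrakk> \<Longrightarrow>
      (a \<bullet> b) \<bullet> c = koszul j k ((a \<bullet> c) \<bullet> b)"

locale lie_superalgebra = superspace scale V
  for scale :: "'k::field \<Rightarrow> 'v::ab_group_add \<Rightarrow> 'v" and V +
  fixes lie :: "'v \<Rightarrow> 'v \<Rightarrow> 'v"
  assumes lie_bilinear: "even_bilinear scale V scale V scale V lie"
    and lie_skew: "\<lbrakk>a \<in> V i; b \<in> V j\<rbrakk> \<Longrightarrow> lie a b = - koszul i j (lie b a)"
    and lie_jacobi: "\<lbrakk>a \<in> V i; b \<in> V j; c \<in> V k\<rbrakk> \<Longrightarrow>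
      lie a (lie b c) - koszul i j (lie b (lie a c)) = lie (lie a b) c"

locale gd_superalgebra = novikov_superalgebra scale V circ + lie_superalgebra scale V lie
  for scale :: "'k::field \<Rightarrow> 'v::ab_group_add \<Rightarrow> 'v" and V
    and circ :: "'v \<Rightarrow> 'v \<Rightarrow> 'v"  (infixl \<open>\<bullet>\<close> 70) and lie +
  assumes gd_compatible: "\<lbrakk>a \<in> V i; b \<in> V j; c \<in> V k\<rbrakk> \<Longrightarrow>
      lie (a \<bullet> b) c - a \<bullet> lie b c + lie a b \<bullet> c
        + koszul i j (lie b (a \<bullet> c)) - koszul j k (lie a c \<bullet> b) = 0"

text \<open>
  The bilinear extension to non-homogeneous arguments of the map sending homogeneous \<open>a, b\<close>
  to \<open>(-1)\<^sup>|\<^sup>a\<^sup>|\<^sup>|\<^sup>b\<^sup>| b \<circ> a\<close>.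
\<close>

definition super_opposite ::
  "(bit \<Rightarrow> 'v::ab_group_add set) \<Rightarrow> ('v \<Rightarrow> 'v \<Rightarrow> 'v) \<Rightarrow> 'v \<Rightarrow> 'v \<Rightarrow> 'v" where
  "super_opposite V circ a b =
     (\<Sum>i\<in>UNIV. \<Sum>j\<in>UNIV. koszul i j (circ (component V j b) (component V i a)))"

definition super_commutator ::
  "(bit \<Rightarrow> 'v::ab_group_add set) \<Rightarrow> ('v \<Rightarrow> 'v \<Rightarrow> 'v) \<Rightarrow> 'v \<Rightarrow> 'v \<Rightarrow> 'v" where
  "super_commutator V circ a b = circ a b - super_opposite V circ a b"


section \<open>Graded \<open>H\<close>-modules and polynomials in \<open>\<lambda>\<close>\<close>

text \<open>A module over \<open>H = k[\<partial>]\<close> is a vector space with a linear operator \<open>D\<close>, the action of \<open>\<partial>\<close>.\<close>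

locale graded_H_module = superspace scale C
  for scale :: "'k::field \<Rightarrow> 'c::ab_group_add \<Rightarrow> 'c" and C +
  fixes D :: "'c \<Rightarrow> 'c"
  assumes D_add: "\<lbrakk>x \<in> graded_sum C; y \<in> graded_sum C\<rbrakk> \<Longrightarrow> D (x + y) = D x + D y"
    and D_scale: "x \<in> graded_sum C \<Longrightarrow> D (scale a x) = scale a (D x)"
    and D_grade: "x \<in> C i \<Longrightarrow> D x \<in> C i"

text \<open>
  Polynomials with coefficients in an abelian group \<open>'c\<close> are elements of \<open>'c poly\<close>.  This type
  plays two roles: as \<open>C[\<lambda>]\<close>, and as the free \<open>H\<close>-module \<open>H \<otimes> V\<close>, with \<open>\<partial>\<close> acting as \<open>pCons 0\<close>.
  The grading and the scalar multiplication are coefficientwise in both cases.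
\<close>

definition poly_grade :: "(bit \<Rightarrow> 'c::zero set) \<Rightarrow> bit \<Rightarrow> 'c poly set" where
  "poly_grade C i = {p. \<forall>n. coeff p n \<in> C i}"

definition poly_scale :: "('k \<Rightarrow> 'c::zero \<Rightarrow> 'c) \<Rightarrow> 'k \<Rightarrow> 'c poly \<Rightarrow> 'c poly" where
  "poly_scale scale a = map_poly (scale a)"

text \<open>
  \<open>subst_poly T f (\<Sum>\<^sub>n \<lambda>\<^sup>n c\<^sub>n) = \<Sum>\<^sub>n T\<^sup>n (f c\<^sub>n)\<close>: the additive map \<open>f\<close> is applied to the
  coefficients and \<open>\<lambda>\<close> is replaced by the operator \<open>T\<close>.
\<close>

definition subst_poly ::
  "('b \<Rightarrow> 'b) \<Rightarrow> ('c::zero \<Rightarrow> 'b::comm_monoid_add) \<Rightarrow> 'c poly \<Rightarrow> 'b" where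
  "subst_poly T f p = (\<Sum>n\<le>degree p. (T ^^ n) (f (coeff p n)))"

text \<open>Multiplication by \<open>\<partial> + \<lambda>\<close> on \<open>C[\<lambda>]\<close>.\<close>

definition mult_D_lambda :: "('c::ab_group_add \<Rightarrow> 'c) \<Rightarrow> 'c poly \<Rightarrow> 'c poly" where
  "mult_D_lambda D p = map_poly D p + pCons 0 p"

text \<open>
  \<open>C[\<lambda>, \<mu>]\<close> is \<open>'c poly poly\<close>, with inner variable \<open>\<lambda>\<close> and outer variable \<open>\<mu>\<close>: the embedding of
  the constants, and multiplication by \<open>\<lambda>\<close> and by \<open>\<mu>\<close>.
\<close>

definition const2 :: "'c::zero \<Rightarrow> 'c poly poly" where
  "const2 c = [:[:c:]:]"

definition mult_lambda :: "'c::zero poly poly \<Rightarrow> 'c poly poly" where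
  "mult_lambda q = map_poly (pCons 0) q"

definition mult_mu :: "'c::zero poly poly \<Rightarrow> 'c poly poly" where
  "mult_mu q = pCons 0 q"

definition mult_lambda_mu :: "'c::ab_group_add poly poly \<Rightarrow> 'c poly poly" where
  "mult_lambda_mu q = mult_lambda q + mult_mu q"


section \<open>Lie conformal superalgebras and their representations\<close>

text \<open>
  Here \<open>br x y \<in> C[\<lambda>]\<close> is the \<open>\<lambda>\<close>-bracket.  In \<open>conf_jacobi\<close>, for \<open>br y z = \<Sum>\<^sub>n \<lambda>\<^sup>n c\<^sub>n\<close>, the first
  summand is \<open>\<Sum>\<^sub>n \<mu>\<^sup>n [x\<^sub>\<lambda> c\<^sub>n]\<close>, and likewise for the others.
\<close>

locale lie_conformal_superalgebra = graded_H_module scale C D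
  for scale :: "'k::field \<Rightarrow> 'c::ab_group_add \<Rightarrow> 'c" and C D +
  fixes br :: "'c \<Rightarrow> 'c \<Rightarrow> 'c poly"
  assumes br_bilinear: "even_bilinear scale C scale C (poly_scale scale) (poly_grade C) br"
    and br_sesqui_left: "\<lbrakk>x \<in> C i; y \<in> C j\<rbrakk> \<Longrightarrow> br (D x) y = - pCons 0 (br x y)"
    and br_sesqui_right: "\<lbrakk>x \<in> C i; y \<in> C j\<rbrakk> \<Longrightarrow> br x (D y) = mult_D_lambda D (br x y)"
    and conf_skew: "\<lbrakk>x \<in> C i; y \<in> C j\<rbrakk> \<Longrightarrow>
      br x y = - koszul i j (subst_poly (\<lambda>q. - mult_D_lambda D q) (\<lambda>c. [:c:]) (br y x))"
    and conf_jacobi: "\<lbrakk>x \<in> C i; y \<in> C j; z \<in> C k\<rbrakk> \<Longrightarrow>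
      subst_poly mult_mu (\<lambda>c. subst_poly mult_lambda const2 (br x c)) (br y z)
      - koszul i j (subst_poly mult_lambda (\<lambda>c. subst_poly mult_mu const2 (br y c)) (br x z))
      = subst_poly mult_lambda (\<lambda>c. subst_poly mult_lambda_mu const2 (br c z)) (br x y)"

locale lie_conformal_representation =
  L: lie_conformal_superalgebra scaleL L DL br + M: graded_H_module scaleM M DM
  for scaleL :: "'k::field \<Rightarrow> 'l::ab_group_add \<Rightarrow> 'l" and L DL br
    and scaleM :: "'k \<Rightarrow> 'm::ab_group_add \<Rightarrow> 'm" and M DM +
  fixes \<rho> :: "'l \<Rightarrow> 'm \<Rightarrow> 'm poly"
  assumes rep_bilinear: "even_bilinear scaleL L scaleM M (poly_scale scaleM) (poly_grade M) \<rho>"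
    and rep_sesqui_left: "\<lbrakk>a \<in> L i; x \<in> M j\<rbrakk> \<Longrightarrow> \<rho> (DL a) x = - pCons 0 (\<rho> a x)"
    and rep_sesqui_right: "\<lbrakk>a \<in> L i; x \<in> M j\<rbrakk> \<Longrightarrow> \<rho> a (DM x) = mult_D_lambda DM (\<rho> a x)"
    and rep_jacobi: "\<lbrakk>a \<in> L i; b \<in> L j; x \<in> M k\<rbrakk> \<Longrightarrow>
      subst_poly mult_mu (\<lambda>y. subst_poly mult_lambda const2 (\<rho> a y)) (\<rho> b x)
      - koszul i j (subst_poly mult_lambda (\<lambda>y. subst_poly mult_mu const2 (\<rho> b y)) (\<rho> a x))
      = subst_poly mult_lambda (\<lambda>c. subst_poly mult_lambda_mu const2 (\<rho> c x)) (br a b)"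
begin

definition faithful :: bool where
  "faithful \<longleftrightarrow> (\<forall>a\<in>graded_sum L. (\<forall>x\<in>graded_sum M. \<rho> a x = 0) \<longrightarrow> a = 0)"

end

text \<open>A finite representation, on the free \<open>H\<close>-module \<open>H \<otimes> U\<close>.\<close>

locale finite_representation =
  U: superspace scaleU U +
  lie_conformal_representation scaleL L DL br "poly_scale scaleU" "poly_grade U" "pCons 0" \<rho>
  for scaleL :: "'k::field \<Rightarrow> 'l::ab_group_add \<Rightarrow> 'l" and L DL br
    and scaleU :: "'k \<Rightarrow> 'u::ab_group_add \<Rightarrow> 'u" and U \<rho> +
  assumes U_fin_dim: "U.fin_dim"

text \<open>
  Finite-dimensional superspaces are represented up to isomorphism by the pairs of
  finite-dimensional subspaces of the space of sequences.
\<close>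

definition seq_scale :: "'k::times \<Rightarrow> (nat \<Rightarrow> 'k) \<Rightarrow> nat \<Rightarrow> 'k" where
  "seq_scale c u = (\<lambda>n. c * u n)"

definition has_finite_faithful_representation ::
  "('k::field \<Rightarrow> 'l::ab_group_add \<Rightarrow> 'l) \<Rightarrow> (bit \<Rightarrow> 'l set) \<Rightarrow> ('l \<Rightarrow> 'l) \<Rightarrow>
   ('l \<Rightarrow> 'l \<Rightarrow> 'l poly) \<Rightarrow> bool" where
  "has_finite_faithful_representation scaleL L DL br \<longleftrightarrow>
     (\<exists>(U :: bit \<Rightarrow> (nat \<Rightarrow> 'k) set) \<rho>.
        finite_representation scaleL L DL br seq_scale U \<rho> \<and>
        lie_conformal_representation.faithful L (poly_grade U) \<rho>)"


section \<open>The quadratic Lie conformal superalgebra\<close>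

text \<open>
  \<open>L(V) = H \<otimes> V\<close> is \<open>'v poly\<close> with grading \<open>poly_grade V\<close>, scalar multiplication
  \<open>poly_scale scale\<close> and \<open>\<partial>\<close> acting as \<open>pCons 0\<close>; its \<open>\<lambda>\<close>-bracket takes values in
  \<open>'v poly poly\<close>, with inner variable \<open>\<partial>\<close> and outer variable \<open>\<lambda>\<close>.  On \<open>V\<close> it is \<open>generator_bracket\<close>,
  and sesqui-linearity forces \<open>[f(\<partial>)a\<^sub>\<lambda> g(\<partial>)b] = f(-\<lambda>) g(\<partial> + \<lambda>) [a\<^sub>\<lambda> b]\<close>.
\<close>

definition generator_bracket ::
  "(bit \<Rightarrow> 'v::ab_group_add set) \<Rightarrow> ('v \<Rightarrow> 'v \<Rightarrow> 'v) \<Rightarrow> ('v \<Rightarrow> 'v \<Rightarrow> 'v) \<Rightarrow>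
   'v \<Rightarrow> 'v \<Rightarrow> 'v poly poly" where
  "generator_bracket V circ lie a b =
     const2 (lie a b) + mult_D_lambda (pCons 0) (const2 (super_opposite V circ a b))
     + pCons 0 (const2 (circ a b))"

definition quadratic_bracket ::
  "(bit \<Rightarrow> 'v::ab_group_add set) \<Rightarrow> ('v \<Rightarrow> 'v \<Rightarrow> 'v) \<Rightarrow> ('v \<Rightarrow> 'v \<Rightarrow> 'v) \<Rightarrow>
   'v poly \<Rightarrow> 'v poly \<Rightarrow> 'v poly poly" where
  "quadratic_bracket V circ lie f g =
     subst_poly (\<lambda>q. - pCons 0 q)
       (\<lambda>a. subst_poly (mult_D_lambda (pCons 0)) (generator_bracket V circ lie a) g) f"


section \<open>Novikov superalgebras are Gelfand--Dorfman superalgebras\<close>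

lemma (in superspace) part_subset_sum: "a \<in> V i \<Longrightarrow> a \<in> graded_sum V"
proof -
  assume a: "a \<in> V i"
  have "0 \<in> V j" for j using subspace_0[OF subspace_part] .
  then have "\<exists>b c. a = b + c \<and> b \<in> V 0 \<and> c \<in> V 1"
    using a by (cases i) (metis add.right_neutral, metis add.left_neutral)
  then show ?thesis unfolding graded_sum_def by blast
qed

lemma (in superspace) component_eqI:
  assumes "a \<in> V i" "b \<in> V (i + 1)"
  shows "component V i (a + b) = a"
  unfolding component_def
proof (rule the_equality)
  show "a \<in> V i \<and> a + b - a \<in> V (i + 1)" using assms by simp
next
  fix a' assume a': "a' \<in> V i \<and> a + b - a' \<in> V (i + 1)"
  have "a' - a \<in> V i" using a' assms subspace_diff[OF subspace_part] by blast
  moreover have "b - (a + b - a') \<in> V (i + 1)"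
    using a' assms subspace_diff[OF subspace_part] by blast
  then have "a' - a \<in> V (i + 1)" by (simp add: algebra_simps)
  ultimately have "a' - a \<in> V 0 \<inter> V 1" by (cases i) auto
  then show "a' = a" using direct by simp
qed

lemma (in superspace) component_sum:
  assumes "a \<in> V 0" "b \<in> V 1"
  shows "component V 0 (a + b) = a" "component V 1 (a + b) = b"
  using component_eqI[of a 0 b] component_eqI[of b 1 a] assms by (simp_all add: add.commute)

lemma (in superspace) component_homogeneous:
  assumes "a \<in> V i"
  shows "component V j a = (if j = i then a else 0)"
proof (cases i)
  case zero
  then show ?thesis
    using assms component_sum[of a 0] subspace_0[OF subspace_part, of 1] by (cases j) simp_all
next
  case one
  then show ?thesis
    using assms component_sum[of 0 a] subspace_0[OF subspace_part, of 0] by (cases j) simp_all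
qed

lemma (in superspace) graded_sum_cases:
  assumes "x \<in> graded_sum V"
  obtains a b where "a \<in> V 0" "b \<in> V 1" "x = a + b"
  using assms unfolding graded_sum_def by blast

lemma UNIV_bit_eq: "(UNIV :: bit set) = {0, 1}"
  by auto

context novikov_superalgebra
begin

abbreviation comm :: "'v \<Rightarrow> 'v \<Rightarrow> 'v" where
  "comm \<equiv> super_commutator V circ"

lemma circ_add_left: "\<lbrakk>x \<in> graded_sum V; x' \<in> graded_sum V; y \<in> graded_sum V\<rbrakk> \<Longrightarrow> (x + x') \<bullet> y = x \<bullet> y + x' \<bullet> y"
  and circ_add_right: "\<lbrakk>x \<in> graded_sum V; y \<in> graded_sum V; y' \<in> graded_sum V\<rbrakk> \<Longrightarrow> x \<bullet> (y + y') = x \<bullet> y + x \<bullet> y'"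
  and circ_scale_left: "\<lbrakk>x \<in> graded_sum V; y \<in> graded_sum V\<rbrakk> \<Longrightarrow> scale c x \<bullet> y = scale c (x \<bullet> y)"
  and circ_scale_right: "\<lbrakk>x \<in> graded_sum V; y \<in> graded_sum V\<rbrakk> \<Longrightarrow> x \<bullet> scale c y = scale c (x \<bullet> y)"
  and circ_grade: "\<lbrakk>x \<in> V i; y \<in> V j\<rbrakk> \<Longrightarrow> x \<bullet> y \<in> V (i + j)"
  using circ_bilinear unfolding even_bilinear_def by simp_all

lemma graded_sum_add: "\<lbrakk>x \<in> graded_sum V; y \<in> graded_sum V\<rbrakk> \<Longrightarrow> x + y \<in> graded_sum V"
proof (elim graded_sum_cases)
  fix a b a' b' assume *: "a \<in> V 0" "b \<in> V 1" "x = a + b" "a' \<in> V 0" "b' \<in> V 1" "y = a' + b'"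
  then have "a + a' \<in> V 0" "b + b' \<in> V 1" using subspace_add[OF subspace_part] by auto
  moreover have "x + y = (a + a') + (b + b')" using * by simp
  ultimately show ?thesis unfolding graded_sum_def by blast
qed

lemma graded_sum_scale: "x \<in> graded_sum V \<Longrightarrow> scale c x \<in> graded_sum V"
proof (elim graded_sum_cases)
  fix a b assume *: "a \<in> V 0" "b \<in> V 1" "x = a + b"
  then have "scale c a \<in> V 0" "scale c b \<in> V 1" using subspace_scale[OF subspace_part] by auto
  moreover have "scale c x = scale c a + scale c b" using * by (simp add: scale_right_distrib)
  ultimately show ?thesis unfolding graded_sum_def by blast
qed

lemma graded_sum_uminus: "x \<in> graded_sum V \<Longrightarrow> - x \<in> graded_sum V"
  using graded_sum_scale[of x "-1"] by simp

lemma component_in: "x \<in> graded_sum V \<Longrightarrow> component V i x \<in> V i"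
  by (elim graded_sum_cases, cases i) (simp_all add: component_sum)

lemma component_add:
  assumes "x \<in> graded_sum V" "y \<in> graded_sum V"
  shows "component V i (x + y) = component V i x + component V i y"
proof -
  obtain a b where x: "a \<in> V 0" "b \<in> V 1" "x = a + b" using assms graded_sum_cases by blast
  obtain a' b' where y: "a' \<in> V 0" "b' \<in> V 1" "y = a' + b'" using assms graded_sum_cases by blast
  have "a + a' \<in> V 0" "b + b' \<in> V 1" using x y subspace_add[OF subspace_part] by auto
  from component_sum[OF this] component_sum[OF x(1,2)] component_sum[OF y(1,2)]
  show ?thesis using x(3) y(3) by (cases i) (simp_all add: algebra_simps)
qed

lemma component_scale:
  assumes "x \<in> graded_sum V"
  shows "component V i (scale c x) = scale c (component V i x)"
proof -
  obtain a b where x: "a \<in> V 0" "b \<in> V 1" "x = a + b" using assms graded_sum_cases by blast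
  have "scale c a \<in> V 0" "scale c b \<in> V 1" using x subspace_scale[OF subspace_part] by auto
  from component_sum[OF this] component_sum[OF x(1,2)]
  show ?thesis using x(3) by (cases i) (simp_all add: scale_right_distrib)
qed

lemma comm_homogeneous:
  assumes "a \<in> V i" "b \<in> V j"
  shows "comm a b = a \<bullet> b - koszul i j (b \<bullet> a)"
proof -
  have zero: "0 \<bullet> x = 0" "x \<bullet> 0 = 0" if "x \<in> graded_sum V" for x
    using circ_scale_left[of x x 0] circ_scale_right[of x x 0] that by simp_all
  note z = zero[OF part_subset_sum[OF assms(1)]] zero[OF part_subset_sum[OF assms(2)]]
  have "0 \<in> graded_sum V" using part_subset_sum subspace_0[OF subspace_part] by blast
  note z = z zero[OF this]
  show ?thesis
    unfolding super_commutator_def super_opposite_def UNIV_bit_eq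
    using z by (cases i; cases j) (simp_all add: component_homogeneous[OF assms(1)]
        component_homogeneous[OF assms(2)] koszul_def)
qed

lemma comm_bilinear: "even_bilinear scale V scale V scale V comm"
  unfolding even_bilinear_def
proof (intro conjI allI ballI)
  fix x x' y assume *: "x \<in> graded_sum V" "x' \<in> graded_sum V" "y \<in> graded_sum V"
  show "comm (x + x') y = comm x y + comm x' y"
    using * unfolding super_commutator_def super_opposite_def UNIV_bit_eq
    by (simp add: circ_add_left circ_add_right component_add koszul_def
        part_subset_sum[OF component_in])
next
  fix x y y' assume *: "x \<in> graded_sum V" "y \<in> graded_sum V" "y' \<in> graded_sum V"
  show "comm x (y + y') = comm x y + comm x y'"
    using * unfolding super_commutator_def super_opposite_def UNIV_bit_eq
    by (simp add: circ_add_left circ_add_right component_add koszul_def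
        part_subset_sum[OF component_in])
next
  fix c x y assume *: "x \<in> graded_sum V" "y \<in> graded_sum V"
  show "comm (scale c x) y = scale c (comm x y)"
    using * unfolding super_commutator_def super_opposite_def UNIV_bit_eq
    by (simp add: circ_scale_left circ_scale_right component_scale koszul_def
        part_subset_sum[OF component_in] scale_right_distrib scale_right_diff_distrib)
next
  fix c x y assume *: "x \<in> graded_sum V" "y \<in> graded_sum V"
  show "comm x (scale c y) = scale c (comm x y)"
    using * unfolding super_commutator_def super_opposite_def UNIV_bit_eq
    by (simp add: circ_scale_left circ_scale_right component_scale koszul_def
        part_subset_sum[OF component_in] scale_right_distrib scale_right_diff_distrib)
next
  fix i j x y assume *: "x \<in> V i" "y \<in> V j"
  have "x \<bullet> y \<in> V (i + j)" "y \<bullet> x \<in> V (i + j)"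
    using circ_grade[OF *] circ_grade[OF *(2) *(1)] by (metis add.commute)+
  then have "x \<bullet> y - koszul i j (y \<bullet> x) \<in> V (i + j)"
    unfolding koszul_def using subspace_diff[OF subspace_part] subspace_add[OF subspace_part]
    by auto
  then show "comm x y \<in> V (i + j)" using comm_homogeneous[OF *] by simp
qed

lemma circ_uminus: "\<lbrakk>x \<in> graded_sum V; y \<in> graded_sum V\<rbrakk> \<Longrightarrow> (- x) \<bullet> y = - (x \<bullet> y)"
  "\<lbrakk>x \<in> graded_sum V; y \<in> graded_sum V\<rbrakk> \<Longrightarrow> x \<bullet> (- y) = - (x \<bullet> y)"
  using circ_scale_left[of x y "-1"] circ_scale_right[of x y "-1"] by simp_all

lemma circ_diff:
  "\<lbrakk>x \<in> graded_sum V; x' \<in> graded_sum V; y \<in> graded_sum V\<rbrakk> \<Longrightarrow> (x - x') \<bullet> y = x \<bullet> y - x' \<bullet> y"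
  "\<lbrakk>x \<in> graded_sum V; y \<in> graded_sum V; y' \<in> graded_sum V\<rbrakk> \<Longrightarrow> x \<bullet> (y - y') = x \<bullet> y - x \<bullet> y'"
  using circ_add_left[of x "- x'" y] circ_add_right[of x y "- y'"]
  by (simp_all add: circ_uminus graded_sum_uminus)

theorem gd_superalgebra_comm: "gd_superalgebra scale V circ comm"
proof (unfold_locales)
  show "even_bilinear scale V scale V scale V comm" by (rule comm_bilinear)
next
  fix a b i j assume *: "a \<in> V i" "b \<in> V j"
  show "comm a b = - koszul i j (comm b a)"
    using comm_homogeneous[OF *] comm_homogeneous[OF *(2) *(1)]
    by (cases i; cases j) (simp_all add: koszul_def)
next
  fix a b c i j k assume *: "a \<in> V i" "b \<in> V j" "c \<in> V k"
  note a = *(1) and b = *(2) and c = *(3)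
  have comm_grade: "comm x y \<in> V (p + q)" if "x \<in> V p" "y \<in> V q" for x y p q
    using comm_bilinear that unfolding even_bilinear_def by blast
  note g = part_subset_sum[OF a] part_subset_sum[OF b] part_subset_sum[OF c]
    part_subset_sum[OF circ_grade[OF a b]] part_subset_sum[OF circ_grade[OF b a]]
    part_subset_sum[OF circ_grade[OF a c]] part_subset_sum[OF circ_grade[OF c a]]
    part_subset_sum[OF circ_grade[OF c b]] part_subset_sum[OF circ_grade[OF b c]]
  note h1 = comm_homogeneous[OF a b] comm_homogeneous[OF a c] comm_homogeneous[OF b c]
  note h = comm_homogeneous[OF a comm_grade[OF b c], unfolded h1]
    comm_homogeneous[OF b comm_grade[OF a c], unfolded h1]
    comm_homogeneous[OF comm_grade[OF a b] c, unfolded h1]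
    comm_homogeneous[OF circ_grade[OF a b] c] comm_homogeneous[OF b circ_grade[OF a c]]
  have l: "a \<bullet> (b \<bullet> c) = (a \<bullet> b) \<bullet> c - koszul i j ((b \<bullet> a) \<bullet> c - b \<bullet> (a \<bullet> c))"
    "a \<bullet> (c \<bullet> b) = (a \<bullet> c) \<bullet> b - koszul i k ((c \<bullet> a) \<bullet> b - c \<bullet> (a \<bullet> b))"
    "b \<bullet> (c \<bullet> a) = (b \<bullet> c) \<bullet> a - koszul j k ((c \<bullet> b) \<bullet> a - c \<bullet> (b \<bullet> a))"
    unfolding left_symmetric[OF a b c, symmetric] left_symmetric[OF a c b, symmetric]
      left_symmetric[OF b c a, symmetric] by simp_all
  note r = right_commutative[OF a b c] right_commutative[OF b a c] right_commutative[OF c a b]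
  note bilin = circ_diff circ_add_left circ_add_right circ_uminus graded_sum_uminus g
  note parity = koszul_def
  show "comm a (comm b c) - koszul i j (comm b (comm a c)) = comm (comm a b) c"
    unfolding h1 h
    by (cases i; cases j; cases k; simp add: parity bilin)
      (simp_all add: l r parity algebra_simps)
  show "comm (a \<bullet> b) c - a \<bullet> comm b c + comm a b \<bullet> c
        + koszul i j (comm b (a \<bullet> c)) - koszul j k (comm a c \<bullet> b) = 0"
    unfolding h1 h
    by (cases i; cases j; cases k; simp add: parity bilin)
      (simp_all add: l r parity algebra_simps)
qed

end

end

theory Submission
  imports Defs "HOL-Library.Product_Plus" "HOL-Library.Nat_Bijection"
begin

text \<open>
  Think of \<open>V\<close> as sitting inside a supercommutative algebra with an even derivation \<open>'\<close>, with
  \<open>a \<circ> b = a b'\<close>; both identities of a Novikov superalgebra then hold. In a module over such an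
  algebra the elements of \<open>V\<close> give operators \<open>l\<^sub>a : u \<mapsto> a u'\<close> and \<open>r\<^sub>a : u \<mapsto> a' u\<close>. They satisfy
  four quadratic relations, which are taken as the definition of a bimodule (locale
  \<open>novikov_bimodule\<close>). For every bimodule \<open>U\<close> the formula

    \<open>\<rho>\<^sub>\<lambda>(a) u = (l\<^sub>a - r\<^sub>a) u + (\<partial> + \<lambda>) r\<^sub>a u + \<lambda> l\<^sub>a u\<close>

  defines a representation of \<open>L(V)\<close> on \<open>H \<otimes> U\<close>: both sides of the Jacobi identity are
  sesqui-linear, so it suffices to compare them on \<open>V\<close> and \<open>U\<close>, where the coefficients of the
  monomials in \<open>\<partial>, \<lambda>, \<mu>\<close> agree by the four relations (\<open>jacobi_defect_zero\<close>). The space \<open>V\<close> itself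
  is a bimodule (\<open>regular_bimodule\<close>), and for it \<open>\<rho>\<close> is the \<open>\<lambda>\<close>-bracket; the same computation
  therefore shows that \<open>L(V)\<close> is a Lie conformal superalgebra (\<open>lie_conformal_quadratic\<close>).

  The representation is faithful as soon as \<open>U\<close> has a homogeneous vector \<open>u\<close> with \<open>l\<^sub>a u = 0\<close> only
  for \<open>a = 0\<close> (\<open>act_faithful\<close>). The regular bimodule need not have one, as \<open>V\<close> may have
  annihilators. Adjoin an even variable \<open>x\<close> with \<open>x' = 1\<close>: then \<open>l\<^sub>a x = a\<close>. The bimodule
  generated by \<open>x\<close> and \<open>V\<close> consists of \<open>V\<close> and of products \<open>x q\<close>, with \<open>q\<close> a polynomial in \<open>V\<close> and
  its derivatives such as \<open>a'\<close>, \<open>a b''\<close>, and it can be infinite-dimensional. But such a \<open>q\<close> can be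
  replaced by the operator \<open>v \<mapsto> v q\<close> on \<open>V\<close>, which supercommutes with all right multiplications
  \<open>v \<mapsto> v \<circ> b = v b'\<close>. The bimodule operations on \<open>x q\<close> can be written in terms of this operator,
  and they make sense for every endomorphism of \<open>V\<close> that supercommutes with the right
  multiplications. With \<open>Q\<close> the space of these endomorphisms, \<open>Q \<oplus> V\<close> is a finite-dimensional
  bimodule in which the identity of \<open>V\<close> plays the role of \<open>x\<close> (\<open>bimodule_ext_module\<close>).
\<close>

section \<open>Substitution of an operator into a polynomial\<close>

definition coeffs_in :: "'c::zero set \<Rightarrow> 'c poly set" where
  "coeffs_in G = {p. \<forall>n. coeff p n \<in> G}"

lemma poly_grade_eq: "poly_grade C i = coeffs_in (C i)"
  by (simp add: poly_grade_def coeffs_in_def)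

lemma pCons_in_coeffs_in: "pCons a p \<in> coeffs_in G \<longleftrightarrow> a \<in> G \<and> p \<in> coeffs_in G"
  unfolding coeffs_in_def by (auto simp: coeff_pCons split: nat.splits)

lemma coeffs_in_induct [consumes 1, case_names 0 pCons]:
  assumes "p \<in> coeffs_in G" "P 0"
    and "\<And>a p. a \<in> G \<Longrightarrow> p \<in> coeffs_in G \<Longrightarrow> P p \<Longrightarrow> P (pCons a p)"
  shows "P p"
  using assms(1)
proof (induction p rule: pCons_induct)
  case 0
  show ?case by (rule assms(2))
next
  case (pCons a p)
  then show ?case using assms(3) by (simp add: pCons_in_coeffs_in)
qed

lemma zero_in_coeffs_in: "0 \<in> G \<Longrightarrow> 0 \<in> coeffs_in G"
  by (simp add: coeffs_in_def)

lemma additive_zero: "additive T \<Longrightarrow> T 0 = 0"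
  by (rule additive.zero)

lemma subst_poly_bound:
  assumes T: "additive T" and f: "f 0 = 0" and N: "degree p \<le> N"
  shows "subst_poly T f p = (\<Sum>n\<le>N. (T ^^ n) (f (coeff p n)))"
  unfolding subst_poly_def
proof (rule sum.mono_neutral_left)
  have "(T ^^ n) 0 = 0" for n
    by (induction n) (simp_all add: additive_zero[OF T])
  then show "\<forall>n\<in>{..N} - {..degree p}. (T ^^ n) (f (coeff p n)) = 0"
    by (simp add: coeff_eq_0 f)
qed (use N in auto)

lemma subst_poly_const: "subst_poly T f [:c:] = f c"
  by (simp add: subst_poly_def)

lemma subst_poly_0: "f 0 = 0 \<Longrightarrow> subst_poly T f 0 = 0"
  by (simp add: subst_poly_def)

lemma subst_poly_pCons:
  assumes T: "additive T" and f: "f 0 = 0"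
  shows "subst_poly T f (pCons c p) = f c + T (subst_poly T f p)"
proof -
  have "subst_poly T f (pCons c p) = (\<Sum>n\<le>Suc (degree p). (T ^^ n) (f (coeff (pCons c p) n)))"
    by (rule subst_poly_bound[of T f, OF T f]) (rule degree_pCons_le)
  also have "\<dots> = f c + (\<Sum>n\<le>degree p. T ((T ^^ n) (f (coeff p n))))"
    by (subst sum.atMost_Suc_shift) simp
  also have "\<dots> = f c + T (subst_poly T f p)"
    by (simp add: subst_poly_def additive.sum[OF T])
  finally show ?thesis .
qed

lemma subst_poly_add:
  assumes T: "additive T" and f: "f 0 = 0"
    and add: "\<And>x y. x \<in> G \<Longrightarrow> y \<in> G \<Longrightarrow> f (x + y) = f x + f y" and G: "0 \<in> G"
    and p: "p \<in> coeffs_in G" and q: "q \<in> coeffs_in G"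
  shows "subst_poly T f (p + q) = subst_poly T f p + subst_poly T f q"
  using p q
proof (induction p arbitrary: q rule: coeffs_in_induct)
  case 0
  then show ?case by (simp add: subst_poly_0 f)
next
  case (pCons a p)
  show ?case
  proof (cases q)
    case q: (pCons b q')
    then show ?thesis
      using pCons by (simp add: subst_poly_pCons[of T f, OF T f] additive.add[OF T] add
          pCons_in_coeffs_in)
  qed
qed

text \<open>
  This is how identities between iterated brackets are moved through \<open>subst_poly\<close>: an operator
  acting on the coefficients and commuting with \<open>T\<close> can be pulled out of the substitution.
\<close>

lemma subst_poly_intertwine:
  assumes T: "additive T" and S: "additive S" and ST: "\<And>x. S (T x) = T (S x)"
    and f: "f 0 = 0" "f' 0 = 0" and h: "h 0 = 0"
    and fh: "\<And>c. c \<in> G \<Longrightarrow> f' (h c) = S (f c)"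
    and p: "p \<in> coeffs_in G"
  shows "subst_poly T f' (map_poly h p) = S (subst_poly T f p)"
  using p
proof (induction p rule: coeffs_in_induct)
  case 0
  then show ?case by (simp add: subst_poly_0 f additive_zero[OF S])
next
  case (pCons a p)
  then show ?case
    by (simp add: map_poly_pCons h subst_poly_pCons[of T f, OF T f(1)]
        subst_poly_pCons[of T f', OF T f(2)] additive.add[OF S] fh ST)
qed

lemma subst_poly_apply:
  assumes "additive T" "additive S" "\<And>x. S (T x) = T (S x)"
    and "f 0 = 0" "f' 0 = 0" and "\<And>c. c \<in> G \<Longrightarrow> f' c = S (f c)"
    and "p \<in> coeffs_in G"
  shows "subst_poly T f' p = S (subst_poly T f p)"
  using subst_poly_intertwine[of T S f f' id G p] assms by (simp add: map_poly_id)

lemma subst_poly_in: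
  assumes "additive T" "f 0 = 0" and "\<And>c. c \<in> G \<Longrightarrow> f c \<in> K" and "0 \<in> K"
    and "\<And>x y. x \<in> K \<Longrightarrow> y \<in> K \<Longrightarrow> x + y \<in> K" and "\<And>x. x \<in> K \<Longrightarrow> T x \<in> K"
    and p: "p \<in> coeffs_in G"
  shows "subst_poly T f p \<in> K"
  using p
  by (induction p rule: coeffs_in_induct)
    (simp_all add: assms subst_poly_0 subst_poly_pCons[of T f, OF assms(1,2)])

lemma additive_pCons: "additive (\<lambda>q :: 'c::ab_group_add poly. pCons 0 q)"
  by unfold_locales simp

lemma additive_uminus: "additive T \<Longrightarrow> additive (\<lambda>q. - T q)"
  by (simp add: additive_def)

lemma additive_neg_pCons: "additive (\<lambda>q :: 'c::ab_group_add poly. - pCons 0 q)"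
  by (intro additive_uminus additive_pCons)

lemma additive_plus: "additive S \<Longrightarrow> additive T \<Longrightarrow> additive (\<lambda>q. S q + T q)"
  by (simp add: additive_def algebra_simps)

lemma additive_map_poly:
  fixes h :: "'c::ab_group_add \<Rightarrow> 'd::ab_group_add"
  assumes "additive h"
  shows "additive (map_poly h)"
  by unfold_locales (rule poly_eqI, simp add: coeff_map_poly additive_zero[OF assms] additive.add[OF
      assms])

lemma additive_mult_D_lambda: "additive D \<Longrightarrow> additive (mult_D_lambda D)"
  unfolding mult_D_lambda_def[abs_def]
  by (intro additive_plus additive_map_poly additive_pCons)

lemma additive_mult_lambda: "additive (mult_lambda :: 'c::ab_group_add poly poly \<Rightarrow> _)"
  unfolding mult_lambda_def[abs_def] by (intro additive_map_poly additive_pCons)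

lemma additive_mult_mu: "additive (mult_mu :: 'c::ab_group_add poly poly \<Rightarrow> _)"
  unfolding mult_mu_def[abs_def] by (rule additive_pCons)

lemma additive_mult_lambda_mu: "additive (mult_lambda_mu :: 'c::ab_group_add poly poly \<Rightarrow> _)"
  unfolding mult_lambda_mu_def[abs_def] by (intro additive_plus additive_mult_lambda additive_mult_mu)

lemma mult_lambda_mu_commute: "mult_lambda (mult_mu q) = mult_mu (mult_lambda q)"
  by (simp add: mult_lambda_def mult_mu_def map_poly_pCons)

section \<open>The conformal action attached to a pair of operations\<close>

text \<open>
  For \<open>l\<close> the product of \<open>V\<close> and \<open>r\<close> its super-opposite this is the bracket of \<open>L(V)\<close> on
  generators, with the commutator written out; hence \<open>quadratic_bracket_eq\<close>.
\<close>

definition bimodule_generator :: "('v \<Rightarrow> 'u \<Rightarrow> 'u) \<Rightarrow> ('v \<Rightarrow> 'u \<Rightarrow> 'u) \<Rightarrow> 'v \<Rightarrow> 'u::ab_group_add \<Rightarrow> 'u poly poly"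
  where "bimodule_generator l r a u =
     const2 (l a u - r a u) + mult_D_lambda (pCons 0) (const2 (r a u)) + pCons 0 (const2 (l a u))"

definition bimodule_action ::
  "('v \<Rightarrow> 'u \<Rightarrow> 'u) \<Rightarrow> ('v \<Rightarrow> 'u \<Rightarrow> 'u) \<Rightarrow> 'v::zero poly \<Rightarrow> 'u::ab_group_add poly \<Rightarrow> 'u poly poly" where
  "bimodule_action l r f m =
     subst_poly (\<lambda>q. - pCons 0 q)
       (\<lambda>a. subst_poly (mult_D_lambda (pCons 0)) (bimodule_generator l r a) m) f"

lemma bimodule_generator_eq:
  "bimodule_generator l r a u = [:[:l a u - r a u, r a u:], [:l a u + r a u:]:]"
  by (simp add: bimodule_generator_def const2_def mult_D_lambda_def map_poly_pCons add.commute)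

lemma quadratic_bracket_eq:
  "quadratic_bracket V circ (super_commutator V circ) = bimodule_action circ (super_opposite V circ)"
proof -
  have "generator_bracket V circ (super_commutator V circ) = bimodule_generator circ (super_opposite
      V circ)"
    by (intro ext) (simp add: generator_bracket_def bimodule_generator_def super_commutator_def)
  then show ?thesis
    by (intro ext) (simp add: quadratic_bracket_def bimodule_action_def)
qed

section \<open>Superspaces and even bilinear maps\<close>

context superspace
begin

lemma zero_in: "0 \<in> V i"
  by (rule subspace_0[OF subspace_part])

lemma graded_sum_eq: "graded_sum V = span (V 0 \<union> V 1)"
  unfolding graded_sum_def span_Un span_eq_iff[THEN iffD2, OF subspace_part] by blast

lemma subspace_graded_sum: "subspace (graded_sum V)"
  unfolding graded_sum_eq by (rule subspace_span)

lemmas zero_in_sum = subspace_0[OF subspace_graded_sum]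
lemmas add_in_sum = subspace_add[OF subspace_graded_sum]
lemmas scale_in_sum = subspace_scale[OF subspace_graded_sum]
lemmas neg_in_sum = subspace_neg[OF subspace_graded_sum]
lemmas diff_in_sum = subspace_diff[OF subspace_graded_sum]

end

lemma even_bilinearD:
  assumes "even_bilinear sX X sY Y sZ Z f"
  shows "\<lbrakk>x \<in> graded_sum X; x' \<in> graded_sum X; y \<in> graded_sum Y\<rbrakk> \<Longrightarrow> f (x + x') y = f x y + f x' y"
    and "\<lbrakk>x \<in> graded_sum X; y \<in> graded_sum Y; y' \<in> graded_sum Y\<rbrakk> \<Longrightarrow> f x (y + y') = f x y + f x y'"
    and "\<lbrakk>x \<in> graded_sum X; y \<in> graded_sum Y\<rbrakk> \<Longrightarrow> f (sX c x) y = sZ c (f x y)"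
    and "\<lbrakk>x \<in> graded_sum X; y \<in> graded_sum Y\<rbrakk> \<Longrightarrow> f x (sY c y) = sZ c (f x y)"
    and "\<lbrakk>x \<in> X i; y \<in> Y j\<rbrakk> \<Longrightarrow> f x y \<in> Z (i + j)"
  using assms unfolding even_bilinear_def by simp_all

lemma even_bilinear_in_sum:
  assumes f: "even_bilinear sX X sY Y sZ Z f"
    and X: "superspace sX X" and Y: "superspace sY Y" and Z: "superspace sZ Z"
    and x: "x \<in> graded_sum X" and y: "y \<in> graded_sum Y"
  shows "f x y \<in> graded_sum Z"
proof -
  obtain a b where a: "a \<in> X 0" "b \<in> X 1" "x = a + b"
    using superspace.graded_sum_cases[OF X x] by blast
  obtain c d where c: "c \<in> Y 0" "d \<in> Y 1" "y = c + d"
    using superspace.graded_sum_cases[OF Y y] by blast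
  note s = superspace.part_subset_sum[OF X a(1)] superspace.part_subset_sum[OF X a(2)]
    superspace.part_subset_sum[OF Y c(1)] superspace.part_subset_sum[OF Y c(2)]
  have "f x y = f a c + f b c + (f a d + f b d)"
    using s by (simp add: a(3) c(3) even_bilinearD[OF f] superspace.add_in_sum[OF X])
  moreover have "f p q \<in> graded_sum Z" if "p \<in> X i" "q \<in> Y j" for p q i j
    using even_bilinearD(5)[OF f that] superspace.part_subset_sum[OF Z] by blast
  ultimately show ?thesis using a c superspace.add_in_sum[OF Z] by metis
qed

lemma even_bilinear_zero:
  assumes f: "even_bilinear sX X sY Y sZ Z f"
    and X: "superspace sX X" and Y: "superspace sY Y"
  shows "y \<in> graded_sum Y \<Longrightarrow> f 0 y = 0" "x \<in> graded_sum X \<Longrightarrow> f x 0 = 0"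
  using even_bilinearD(1)[OF f superspace.zero_in_sum[OF X] superspace.zero_in_sum[OF X], of y]
    even_bilinearD(2)[OF f _ superspace.zero_in_sum[OF Y] superspace.zero_in_sum[OF Y], of x]
  by auto

lemma even_bilinear_minus:
  assumes f: "even_bilinear sX X sY Y sZ Z f"
    and X: "superspace sX X" and Y: "superspace sY Y"
  shows "\<lbrakk>x \<in> graded_sum X; y \<in> graded_sum Y\<rbrakk> \<Longrightarrow> f (- x) y = - f x y"
    and "\<lbrakk>x \<in> graded_sum X; y \<in> graded_sum Y\<rbrakk> \<Longrightarrow> f x (- y) = - f x y"
    and "\<lbrakk>x \<in> graded_sum X; x' \<in> graded_sum X; y \<in> graded_sum Y\<rbrakk> \<Longrightarrow> f (x - x') y = f x y - f x' y"
    and "\<lbrakk>x \<in> graded_sum X; y \<in> graded_sum Y; y' \<in> graded_sum Y\<rbrakk> \<Longrightarrow> f x (y - y') = f x y - f x y'"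
proof -
  note Xn = superspace.neg_in_sum[OF X] and Yn = superspace.neg_in_sum[OF Y]
  show 1: "f (- x) y = - f x y" if "x \<in> graded_sum X" "y \<in> graded_sum Y" for x y
    using even_bilinearD(1)[OF f that(1) Xn[OF that(1)] that(2)] even_bilinear_zero(1)[OF f X Y that(2)]
    by (simp add: eq_neg_iff_add_eq_0 add.commute)
  show 2: "f x (- y) = - f x y" if "x \<in> graded_sum X" "y \<in> graded_sum Y" for x y
    using even_bilinearD(2)[OF f that Yn[OF that(2)]] even_bilinear_zero(2)[OF f X Y that(1)]
    by (simp add: eq_neg_iff_add_eq_0 add.commute)
  show "f (x - x') y = f x y - f x' y"
    if "x \<in> graded_sum X" "x' \<in> graded_sum X" "y \<in> graded_sum Y"
    using even_bilinearD(1)[OF f that(1) Xn[OF that(2)] that(3)] 1 that by simp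
  show "f x (y - y') = f x y - f x y'"
    if "x \<in> graded_sum X" "y \<in> graded_sum Y" "y' \<in> graded_sum Y"
    using even_bilinearD(2)[OF f that(1,2) Yn[OF that(3)]] 2 that by simp
qed

lemma graded_sum_poly_grade:
  fixes V :: "bit \<Rightarrow> 'v::ab_group_add set"
  assumes "p \<in> graded_sum (poly_grade V)"
  shows "p \<in> coeffs_in (graded_sum V)"
  using assms unfolding graded_sum_def coeffs_in_def poly_grade_def by fastforce

lemma graded_H_module_poly:
  fixes scale :: "'k::field \<Rightarrow> 'v::ab_group_add \<Rightarrow> 'v"
  assumes "superspace scale V"
  shows "graded_H_module (poly_scale scale) (poly_grade V) (pCons 0)"
proof -
  interpret superspace scale V by fact
  have c: "coeff (poly_scale scale c p) n = scale c (coeff p n)" for c p n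
    by (simp add: poly_scale_def coeff_map_poly)
  interpret P: vector_space "poly_scale scale"
    by unfold_locales (rule poly_eqI, simp add: c scale_right_distrib scale_left_distrib)+
  show ?thesis
  proof unfold_locales
    show "P.subspace (poly_grade V i)" for i
      unfolding P.subspace_def poly_grade_def
      by (auto simp: c zero_in subspace_add[OF subspace_part] subspace_scale[OF subspace_part])
    show "poly_grade V 0 \<inter> poly_grade V 1 = {0}"
      using direct zero_in by (fastforce simp: poly_grade_def intro: poly_eqI)
    show "pCons 0 (poly_scale scale a x) = poly_scale scale a (pCons 0 x)" for a and x :: "'v poly"
      by (simp add: poly_scale_def map_poly_pCons)
    show "pCons 0 x \<in> poly_grade V i" if "x \<in> poly_grade V i" for x i
      using that by (simp add: poly_grade_eq pCons_in_coeffs_in zero_in)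
  qed simp_all
qed

section \<open>Bimodules over a Novikov superalgebra\<close>

text \<open>
  In the differential picture \<open>l a u = a u'\<close> and \<open>r a u = a' u\<close>. Thus \<open>r_r\<close> is supercommutativity,
  \<open>r_l\<close> is \<open>b' a u' = \<plusminus> (a b') u'\<close>, \<open>l_l\<close> expresses that \<open>a (b u')' - a b' u' = a b u''\<close> is
  supersymmetric in \<open>a\<close> and \<open>b\<close>, and in \<open>l_r\<close> both sides are \<open>a b'' u\<close>. Writing both operations
  from the left leaves only signs between \<open>a\<close> and \<open>b\<close>.
\<close>

locale novikov_bimodule = novikov_superalgebra scale V circ + U: superspace scaleU U
  for scale :: "'k::field \<Rightarrow> 'v::ab_group_add \<Rightarrow> 'v" and V
    and circ :: "'v \<Rightarrow> 'v \<Rightarrow> 'v"  (infixl \<open>\<bullet>\<close> 70)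
    and scaleU :: "'k \<Rightarrow> 'u::ab_group_add \<Rightarrow> 'u" and U +
  fixes l r :: "'v \<Rightarrow> 'u \<Rightarrow> 'u"
  assumes l_bilinear: "even_bilinear scale V scaleU U scaleU U l"
    and r_bilinear: "even_bilinear scale V scaleU U scaleU U r"
    and r_r: "\<lbrakk>a \<in> V i; b \<in> V j; u \<in> U k\<rbrakk> \<Longrightarrow> r b (r a u) = koszul i j (r a (r b u))"
    and r_l: "\<lbrakk>a \<in> V i; b \<in> V j; u \<in> U k\<rbrakk> \<Longrightarrow> r b (l a u) = koszul i j (l (a \<bullet> b) u)"
    and l_l: "\<lbrakk>a \<in> V i; b \<in> V j; u \<in> U k\<rbrakk> \<Longrightarrow>
      l a (l b u) - l (a \<bullet> b) u = koszul i j (l b (l a u) - l (b \<bullet> a) u)"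
    and l_r: "\<lbrakk>a \<in> V i; b \<in> V j; u \<in> U k\<rbrakk> \<Longrightarrow>
      l a (r b u) - l (a \<bullet> b) u = r (a \<bullet> b) u - r a (r b u)"
begin

abbreviation gen :: "'v \<Rightarrow> 'u \<Rightarrow> 'u poly poly" where "gen \<equiv> bimodule_generator l r"
abbreviation act :: "'v poly \<Rightarrow> 'u poly \<Rightarrow> 'u poly poly" where "act \<equiv> bimodule_action l r"
abbreviation VP :: "'v poly set" where "VP \<equiv> coeffs_in (graded_sum V)"
abbreviation UP :: "'u poly set" where "UP \<equiv> coeffs_in (graded_sum U)"

lemmas l_simps = even_bilinearD(1-4)[OF l_bilinear]
  even_bilinear_zero[OF l_bilinear superspace_axioms U.superspace_axioms]
  even_bilinear_minus[OF l_bilinear superspace_axioms U.superspace_axioms]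
lemmas r_simps = even_bilinearD(1-4)[OF r_bilinear]
  even_bilinear_zero[OF r_bilinear superspace_axioms U.superspace_axioms]
  even_bilinear_minus[OF r_bilinear superspace_axioms U.superspace_axioms]
lemmas l_in = even_bilinear_in_sum[OF l_bilinear superspace_axioms U.superspace_axioms
    U.superspace_axioms]
lemmas r_in = even_bilinear_in_sum[OF r_bilinear superspace_axioms U.superspace_axioms
    U.superspace_axioms]
lemmas l_grade = even_bilinearD(5)[OF l_bilinear]
lemmas r_grade = even_bilinearD(5)[OF r_bilinear]

abbreviation MD :: "'u poly poly \<Rightarrow> 'u poly poly" where "MD \<equiv> mult_D_lambda (pCons 0)"
abbreviation scaleP :: "'k \<Rightarrow> 'u poly poly \<Rightarrow> 'u poly poly" where
  "scaleP \<equiv> poly_scale (poly_scale scaleU)"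

lemma additive_MD: "additive MD"
  by (intro additive_mult_D_lambda additive_pCons)

lemma gen_simps:
  "a \<in> graded_sum V \<Longrightarrow> gen a 0 = 0"
  "u \<in> graded_sum U \<Longrightarrow> gen 0 u = 0"
  "\<lbrakk>a \<in> graded_sum V; b \<in> graded_sum V; u \<in> graded_sum U\<rbrakk> \<Longrightarrow> gen (a + b) u = gen a u + gen b u"
  "\<lbrakk>a \<in> graded_sum V; u \<in> graded_sum U; w \<in> graded_sum U\<rbrakk> \<Longrightarrow> gen a (u + w) = gen a u + gen a w"
  by (simp_all add: bimodule_generator_eq l_simps r_simps)

lemma gen_scale:
  "\<lbrakk>a \<in> graded_sum V; u \<in> graded_sum U\<rbrakk> \<Longrightarrow> gen (scale c a) u = scaleP c (gen a u)"
  "\<lbrakk>a \<in> graded_sum V; u \<in> graded_sum U\<rbrakk> \<Longrightarrow> gen a (scaleU c u) = scaleP c (gen a u)"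
  by (simp_all add: bimodule_generator_eq l_simps r_simps poly_scale_def map_poly_pCons
      U.scale_right_diff_distrib U.scale_right_distrib)

text \<open>
  The action is a double substitution: the inner one puts \<open>\<partial> + \<lambda>\<close> for \<open>\<partial>\<close> in the element of
  \<open>H \<otimes> U\<close>, the outer one puts \<open>-\<lambda>\<close> for \<open>\<partial>\<close> in the element of \<open>L(V)\<close>.
\<close>

lemma inner_add:
  assumes "a \<in> graded_sum V" "m \<in> UP" "n \<in> UP"
  shows "subst_poly MD (gen a) (m + n) = subst_poly MD (gen a) m + subst_poly MD (gen a) n"
  using assms by (intro subst_poly_add[OF additive_MD, where G = "graded_sum U"])
    (auto simp: gen_simps U.zero_in_sum)

lemma inner_zero: "m \<in> UP \<Longrightarrow> subst_poly MD (gen 0) m = 0"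
  by (induction m rule: coeffs_in_induct)
    (simp_all add: subst_poly_0 subst_poly_pCons[OF additive_MD] gen_simps zero_in_sum
        additive_zero[OF additive_MD])

lemma inner_add_left:
  assumes "a \<in> graded_sum V" "b \<in> graded_sum V" "m \<in> UP"
  shows "subst_poly MD (gen (a + b)) m = subst_poly MD (gen a) m + subst_poly MD (gen b) m"
  using assms(3)
  by (induction m rule: coeffs_in_induct)
    (simp_all add: assms subst_poly_0 subst_poly_pCons[OF additive_MD] gen_simps add_in_sum
        additive.add[OF additive_MD])

lemma act_0: "m \<in> UP \<Longrightarrow> act 0 m = 0"
  by (simp add: bimodule_action_def subst_poly_0 inner_zero)

lemma act_pCons:
  "m \<in> UP \<Longrightarrow> act (pCons a f) m = subst_poly MD (gen a) m - pCons 0 (act f m)"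
  unfolding bimodule_action_def
  by (subst subst_poly_pCons) (rule additive_neg_pCons, simp_all add: inner_zero)

lemma act_D: "m \<in> UP \<Longrightarrow> act (pCons 0 f) m = - pCons 0 (act f m)"
  by (simp add: act_pCons inner_zero)

lemma act_const: "act [:a:] [:u:] = gen a u"
  by (simp add: bimodule_action_def subst_poly_const)

lemma act_right_0: "f \<in> VP \<Longrightarrow> act f 0 = 0"
  by (induction f rule: coeffs_in_induct)
    (simp_all add: act_0 act_pCons zero_in_coeffs_in U.zero_in_sum subst_poly_0 gen_simps)

lemma act_add_left:
  assumes "f \<in> VP" "g \<in> VP" "m \<in> UP"
  shows "act (f + g) m = act f m + act g m"
  unfolding bimodule_action_def
  using assms by (intro subst_poly_add[OF additive_neg_pCons, where G = "graded_sum V"])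
    (auto simp: inner_zero inner_add_left zero_in_sum)

lemma act_add_right:
  assumes "f \<in> VP" "m \<in> UP" "n \<in> UP"
  shows "act f (m + n) = act f m + act f n"
  using assms(1)
proof (induction f rule: coeffs_in_induct)
  case 0
  have "m + n \<in> UP" using assms unfolding coeffs_in_def by (simp add: U.add_in_sum)
  then show ?case by (simp add: act_0 assms)
next
  case (pCons a f)
  have "m + n \<in> UP" using assms unfolding coeffs_in_def by (simp add: U.add_in_sum)
  with pCons show ?case by (simp add: act_pCons assms inner_add)
qed

lemma MD_pCons: "pCons 0 (MD q) = MD (pCons 0 q)"
  by (simp add: mult_D_lambda_def map_poly_pCons)

lemma act_right_D:
  assumes "f \<in> VP" "m \<in> UP"
  shows "act f (pCons 0 m) = MD (act f m)"
proof -
  have m: "pCons 0 m \<in> UP" using assms by (simp add: pCons_in_coeffs_in U.zero_in_sum)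
  show ?thesis using assms(1)
    by (induction f rule: coeffs_in_induct)
     (simp_all add: act_0 act_pCons assms m additive_zero[OF additive_MD] subst_poly_pCons[OF additive_MD]
      gen_simps MD_pCons additive.diff[OF additive_MD])
qed

lemma additive_scaleP: "additive (scaleP c)"
  unfolding poly_scale_def[abs_def] by (intro additive_map_poly additive.intro U.scale_right_distrib)

lemma scaleP_MD: "scaleP c (MD q) = MD (scaleP c q)"
  unfolding mult_D_lambda_def additive.add[OF additive_scaleP]
  by (intro arg_cong2[where f = plus])
    (simp_all add: poly_scale_def map_poly_pCons map_poly_map_poly o_def)

lemma scaleP_neg_pCons: "scaleP c (- pCons 0 q) = - pCons 0 (scaleP c q)"
  unfolding additive.minus[OF additive_scaleP] by (simp add: poly_scale_def map_poly_pCons)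

lemma inner_scale:
  assumes "a \<in> graded_sum V" "m \<in> UP"
  shows "subst_poly MD (gen (scale c a)) m = scaleP c (subst_poly MD (gen a) m)"
    and "subst_poly MD (gen a) (poly_scale scaleU c m) = scaleP c (subst_poly MD (gen a) m)"
  using subst_poly_apply[of MD "scaleP c" "gen a" "gen (scale c a)" "graded_sum U" m]
    subst_poly_intertwine[of MD "scaleP c" "gen a" "gen a" "scaleU c" "graded_sum U" m] assms
  by (simp_all add: additive_MD additive_scaleP scaleP_MD gen_simps gen_scale scale_in_sum
      poly_scale_def[of scaleU])

lemma act_scale:
  assumes "f \<in> VP" "m \<in> UP"
  shows "act (poly_scale scale c f) m = scaleP c (act f m)"
    and "act f (poly_scale scaleU c m) = scaleP c (act f m)"
proof -
  show "act (poly_scale scale c f) m = scaleP c (act f m)"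
    unfolding bimodule_action_def poly_scale_def[of scale]
    by (rule subst_poly_intertwine[where G = "graded_sum V"])
      (use assms in \<open>simp_all only: additive_neg_pCons additive_scaleP scaleP_neg_pCons inner_scale
        inner_zero scale_zero_right\<close>)
  show "act f (poly_scale scaleU c m) = scaleP c (act f m)"
    unfolding bimodule_action_def
    by (rule subst_poly_apply[where G = "graded_sum V"])
      (use assms in \<open>simp_all only: additive_neg_pCons additive_scaleP scaleP_neg_pCons inner_scale
        inner_zero additive_zero[OF additive_scaleP] zero_in_sum\<close>)
qed

text \<open>
  Used twice: with \<open>A\<close>, \<open>B\<close>, \<open>K\<close> the full spaces, so that iterated actions stay in the domain
  where the operations are bilinear, and with homogeneous parts, for the grading.
\<close>

lemma act_in:
  assumes A: "A \<subseteq> graded_sum V" and B: "B \<subseteq> graded_sum U" and K: "U.subspace K"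
    and lr: "\<And>a u. \<lbrakk>a \<in> A; u \<in> B\<rbrakk> \<Longrightarrow> l a u \<in> K \<and> r a u \<in> K"
    and f: "f \<in> coeffs_in A" and m: "m \<in> coeffs_in B"
  shows "act f m \<in> coeffs_in (coeffs_in K)"
proof -
  let ?K = "coeffs_in (coeffs_in K)"
  note K_simps = U.subspace_0[OF K] U.subspace_add[OF K] U.subspace_neg[OF K] U.subspace_diff[OF K]
  have K0: "0 \<in> ?K" by (simp add: coeffs_in_def K_simps)
  have Kadd: "x + y \<in> ?K" if "x \<in> ?K" "y \<in> ?K" for x y
    using that by (simp add: coeffs_in_def K_simps)
  have Kneg: "- x \<in> ?K" if "x \<in> ?K" for x
    using that by (simp add: coeffs_in_def K_simps)
  have KpCons: "pCons 0 x \<in> ?K" if "x \<in> ?K" for x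
    using that by (simp add: pCons_in_coeffs_in zero_in_coeffs_in K_simps)
  have KD: "map_poly (pCons 0) x \<in> ?K" if "x \<in> ?K" for x
    using that by (auto simp: coeffs_in_def K_simps coeff_pCons coeff_map_poly split: nat.splits)
  have KMD: "MD x \<in> ?K" if "x \<in> ?K" for x
    using that unfolding mult_D_lambda_def by (intro Kadd KD KpCons)
  have mUP: "m \<in> UP"
    using m B unfolding coeffs_in_def by blast
  have inner: "subst_poly MD (gen a) m \<in> ?K" if a: "a \<in> A" for a
  proof (rule subst_poly_in[OF additive_MD])
    show "gen a u \<in> ?K" if u: "u \<in> B" for u
      using lr[OF a u]
      by (simp add: bimodule_generator_eq pCons_in_coeffs_in zero_in_coeffs_in K_simps)
    show "m \<in> coeffs_in B" by fact
    show "gen a 0 = 0" using a A by (auto simp: gen_simps)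
  qed (fact K0 Kadd KMD)+
  show ?thesis
    unfolding bimodule_action_def
  proof (rule subst_poly_in)
    show "f \<in> coeffs_in A" by fact
    show "subst_poly MD (gen 0) m = 0" by (rule inner_zero[OF mUP])
    show "additive (\<lambda>q :: 'u poly poly. - pCons 0 q)" by (rule additive_neg_pCons)
    show "- pCons 0 q \<in> ?K" if "q \<in> ?K" for q by (intro Kneg KpCons that)
  qed (fact inner K0 Kadd)+
qed

lemma act_in_sum: "\<lbrakk>f \<in> VP; m \<in> UP\<rbrakk> \<Longrightarrow> act f m \<in> coeffs_in UP"
  by (rule act_in[OF order_refl order_refl U.subspace_graded_sum]) (simp_all add: l_in r_in)

lemma act_grade:
  assumes "f \<in> poly_grade V i" "m \<in> poly_grade U j"
  shows "act f m \<in> poly_grade (poly_grade U) (i + j)"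
  unfolding poly_grade_eq
proof -
  show "act f m \<in> coeffs_in (coeffs_in (U (i + j)))"
  proof (rule act_in)
    show "f \<in> coeffs_in (V i)" "m \<in> coeffs_in (U j)" using assms by (simp_all only: poly_grade_eq)
    show "U.subspace (U (i + j))" by (rule U.subspace_part)
    show "V i \<subseteq> graded_sum V" "U j \<subseteq> graded_sum U" using part_subset_sum U.part_subset_sum by blast+
    show "l a u \<in> U (i + j) \<and> r a u \<in> U (i + j)" if "a \<in> V i" "u \<in> U j" for a u
      using l_grade[OF that] r_grade[OF that] ..
  qed
qed

lemma poly_grade_sums:
  "graded_sum (poly_grade V) \<subseteq> VP" "graded_sum (poly_grade U) \<subseteq> UP"
  using graded_sum_poly_grade by blast+

lemma act_bilinear:
  "even_bilinear (poly_scale scale) (poly_grade V) (poly_scale scaleU) (poly_grade U)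
     scaleP (poly_grade (poly_grade U)) act"
  unfolding even_bilinear_def
  using act_add_left act_add_right act_scale act_grade poly_grade_sums by (auto simp: subset_iff)

end

section \<open>The regular bimodule\<close>

lemma koszul_add: "koszul i j (x + y) = koszul i j x + koszul i j y"
  and koszul_uminus: "koszul i j (- x) = - koszul i j x"
  and koszul_diff: "koszul i j (x - y) = koszul i j x - koszul i j y"
  and koszul_0: "koszul i j 0 = 0"
  and koszul_koszul: "koszul i j (koszul i j x) = x"
  by (simp_all add: koszul_def)

lemma koszul_commute: "koszul i j = koszul j i"
  by (intro ext) (simp add: koszul_def mult.commute)

lemma additive_koszul: "additive T \<Longrightarrow> koszul i j (T x) = T (koszul i j x)"
  by (simp add: koszul_def additive.minus)

context novikov_superalgebra
begin

abbreviation opp :: "'v \<Rightarrow> 'v \<Rightarrow> 'v" where "opp \<equiv> super_opposite V circ"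
abbreviation br :: "'v poly \<Rightarrow> 'v poly \<Rightarrow> 'v poly poly" where "br \<equiv> bimodule_action circ opp"

lemma opp_eq: "opp a b = a \<bullet> b - comm a b"
  by (simp add: super_commutator_def)

lemma opp_homogeneous: "\<lbrakk>a \<in> V i; b \<in> V j\<rbrakk> \<Longrightarrow> opp a b = koszul i j (b \<bullet> a)"
  by (simp add: opp_eq comm_homogeneous)

lemma opp_bilinear: "even_bilinear scale V scale V scale V opp"
  unfolding even_bilinear_def opp_eq
  using even_bilinearD[OF comm_bilinear]
  by (auto simp: circ_add_left circ_add_right circ_scale_left circ_scale_right scale_right_diff_distrib
     circ_grade subspace_diff[OF subspace_part] simp del: add_bit_eq_xor)

text \<open>
  The relation \<open>l_l\<close> is left symmetry. In the others \<open>opp b c\<close> equals \<open>c \<circ> b\<close> up to sign, so \<open>r_r\<close>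
  and \<open>r_l\<close> become right commutativity, and \<open>l_r\<close> becomes left symmetry of \<open>a, c, b\<close> up to right
  commutativity.
\<close>

lemma regular_bimodule: "novikov_bimodule scale V circ scale V circ opp"
proof unfold_locales
  fix a b c i j k assume abc: "a \<in> V i" "b \<in> V j" "c \<in> V k"
  note g = circ_grade[OF abc(1,2)] circ_grade[OF abc(2,1)] circ_grade[OF abc(1,3)]
    circ_grade[OF abc(3,1)] circ_grade[OF abc(2,3)] circ_grade[OF abc(3,2)]
  have opp_koszul: "opp x (koszul p q y) = koszul p q (opp x y)"
    "x \<bullet> koszul p q y = koszul p q (x \<bullet> y)"  if "x \<in> graded_sum V" "y \<in> graded_sum V" for x y p q
    using that by (simp_all add: koszul_def circ_uminus even_bilinear_minus[OF opp_bilinear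
        superspace_axioms superspace_axioms])
  note s = part_subset_sum[OF abc(1)] part_subset_sum[OF abc(2)] part_subset_sum[OF abc(3)]
    g[THEN part_subset_sum]
  note h = opp_homogeneous[OF abc(1,2)] opp_homogeneous[OF abc(1,3)] opp_homogeneous[OF abc(2,3)]
    opp_homogeneous[OF abc(2) g(3)] opp_homogeneous[OF abc(1) g(6)]
    opp_homogeneous[OF abc(2) g(4)] opp_homogeneous[OF g(1) abc(3)]
  show "opp b (opp a c) = koszul i j (opp a (opp b c))"
    using right_commutative[OF abc(3,1,2)]
    by (simp add: h opp_koszul s del: add_bit_eq_xor) (cases i; cases j; cases k; simp add: koszul_def)
  show "opp b (a \<bullet> c) = koszul i j ((a \<bullet> b) \<bullet> c)"
    using right_commutative[OF abc]
    by (simp add: h opp_koszul s del: add_bit_eq_xor) (cases i; cases j; cases k; simp add: koszul_def)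
  show "a \<bullet> (b \<bullet> c) - (a \<bullet> b) \<bullet> c = koszul i j (b \<bullet> (a \<bullet> c) - (b \<bullet> a) \<bullet> c)"
    using left_symmetric[OF abc]
    by (cases i; cases j; cases k; simp add: koszul_def algebra_simps)
  show "a \<bullet> (opp b c) - (a \<bullet> b) \<bullet> c = opp (a \<bullet> b) c - opp a (opp b c)"
    using left_symmetric[OF abc(1,3,2)] right_commutative[OF abc] right_commutative[OF abc(3,1,2)]
    by (simp add: h opp_koszul s del: add_bit_eq_xor) (cases i; cases j; cases k; simp add:
        koszul_def algebra_simps)
qed (fact circ_bilinear opp_bilinear)+

end

section \<open>The Jacobi identity\<close>

definition mult_D :: "'u::ab_group_add poly poly poly \<Rightarrow> 'u poly poly poly" where
  "mult_D = map_poly (map_poly (pCons 0))"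

lemma additive_mult_D: "additive mult_D"
  unfolding mult_D_def by (intro additive_map_poly additive_pCons)

lemma additive_const2: "const2 (x + y :: 'c::ab_group_add) = const2 x + const2 y"
  by (simp add: const2_def)

lemma const2_0: "const2 0 = 0"
  by (simp add: const2_def)

text \<open>
  The properties that \<open>\<lambda>\<close>, \<open>\<mu>\<close> and \<open>\<lambda> + \<mu>\<close> share as operators on \<open>U[\<partial>, \<lambda>, \<mu>]\<close>; stating the lemmas
  for such operators treats \<open>\<rho>\<^sub>\<lambda> \<rho>\<^sub>\<mu>\<close>, \<open>\<rho>\<^sub>\<mu> \<rho>\<^sub>\<lambda>\<close> and \<open>\<rho>\<^sub>\<lambda>\<^sub>+\<^sub>\<mu>\<close> together.
\<close>

definition shift_op :: "('u::ab_group_add poly poly poly \<Rightarrow> 'u poly poly poly) \<Rightarrow> bool" where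
  "shift_op S \<longleftrightarrow> additive S \<and> (\<forall>q. S (mult_D q) = mult_D (S q))
     \<and> (\<forall>q. S (mult_lambda q) = mult_lambda (S q)) \<and> (\<forall>q. S (mult_mu q) = mult_mu (S q))"

lemma shift_op_mult_lambda: "shift_op mult_lambda"
  by (simp add: shift_op_def additive_mult_lambda mult_lambda_mu_commute)
    (simp add: mult_lambda_def mult_D_def map_poly_map_poly o_def map_poly_pCons)

lemma shift_op_mult_mu: "shift_op mult_mu"
  by (simp add: shift_op_def additive_mult_mu mult_lambda_mu_commute)
    (simp add: mult_mu_def mult_D_def map_poly_pCons)

lemma shift_opD:
  assumes "shift_op S"
  shows "additive S" "S (mult_D q) = mult_D (S q)" "S (mult_lambda q) = mult_lambda (S q)"
    "S (mult_mu q) = mult_mu (S q)"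
  using assms by (simp_all add: shift_op_def)

lemma shift_op_mult_lambda_mu: "shift_op mult_lambda_mu"
  unfolding shift_op_def mult_lambda_mu_def additive.add[OF additive_mult_D]
    additive.add[OF additive_mult_lambda] additive.add[OF additive_mult_mu]
    shift_opD(2)[OF shift_op_mult_lambda] shift_opD(2)[OF shift_op_mult_mu] mult_lambda_mu_commute
  by (simp add: additive_mult_lambda_mu[unfolded mult_lambda_mu_def[abs_def]])

lemmas mult_lambda_mu_mult_lambda = shift_opD(3)[OF shift_op_mult_lambda_mu]
lemmas mult_D_mult_lambda = shift_opD(2)[OF shift_op_mult_lambda, symmetric]

definition eval_at :: "('u::ab_group_add poly poly poly \<Rightarrow> 'u poly poly poly) \<Rightarrow> 'u poly poly \<Rightarrow> 'u
    poly poly poly" where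
  "eval_at S p = subst_poly S const2 p"

lemma eval_at_pCons: "shift_op S \<Longrightarrow> eval_at S (pCons c p) = const2 c + S (eval_at S p)"
  unfolding eval_at_def by (rule subst_poly_pCons) (simp_all add: shift_op_def const2_0)

lemma eval_at_0: "eval_at S 0 = 0"
  by (simp add: eval_at_def subst_poly_0 const2_0)

lemma eval_at_add: "shift_op S \<Longrightarrow> eval_at S (p + q) = eval_at S p + eval_at S q"
  unfolding eval_at_def
  by (rule subst_poly_add[where G = UNIV]) (simp_all add: shift_op_def const2_0 additive_const2
      coeffs_in_def)

lemma additive_eval_at: "shift_op S \<Longrightarrow> additive (eval_at S)"
  by (simp add: additive_def eval_at_add)

lemma eval_at_neg_pCons: "shift_op S \<Longrightarrow> eval_at S (- pCons 0 p) = - S (eval_at S p)"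
  by (simp only: additive.minus[OF additive_eval_at] eval_at_pCons const2_0 add_0)

lemma eval_at_mult_D_lambda:
  assumes "shift_op S"
  shows "eval_at S (mult_D_lambda (pCons 0) p) = mult_D (eval_at S p) + S (eval_at S p)"
proof -
  have "eval_at S (map_poly (pCons 0) p) = mult_D (eval_at S p)"
    unfolding eval_at_def using assms
    by (intro subst_poly_intertwine[where G = UNIV])
      (simp_all add: shift_op_def additive_mult_D const2_0, simp_all add: const2_def mult_D_def
          map_poly_pCons coeffs_in_def)
  with assms show ?thesis
    by (simp add: mult_D_lambda_def eval_at_add eval_at_pCons const2_0)
qed

lemma subst_poly_fun_add:
  assumes T: "additive T" and "f 0 = 0" "g 0 = 0" "h 0 = 0"
    and "\<And>c. c \<in> G \<Longrightarrow> h c = f c + g c" "p \<in> coeffs_in G"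
  shows "subst_poly T h p = subst_poly T f p + subst_poly T g p"
  using assms(6)
  by (induction p rule: coeffs_in_induct)
    (simp_all add: subst_poly_0 assms(2-5) subst_poly_pCons[of T h, OF T \<open>h 0 = 0\<close>]
     subst_poly_pCons[of T f, OF T \<open>f 0 = 0\<close>]  subst_poly_pCons[of T g, OF T \<open>g 0 = 0\<close>]
         additive.add[OF T])

lemma subst_poly_uminus:
  assumes T: "additive T" and "f 0 = 0" and "\<And>c. c \<in> G \<Longrightarrow> f (- c) = - f c" and "p \<in> coeffs_in G"
  shows "subst_poly T f (- p) = - subst_poly T f p"
proof -
  have "subst_poly T f (map_poly uminus p) = - subst_poly T f p"
    using assms by (intro subst_poly_intertwine[where G = G]) (simp_all add: additive_def additive.minus)
  moreover have "map_poly uminus p = - p" by (rule poly_eqI) (simp add: coeff_map_poly)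
  ultimately show ?thesis by simp
qed

context novikov_bimodule
begin

lemma VP_simps: "0 \<in> VP" "f \<in> VP \<Longrightarrow> g \<in> VP \<Longrightarrow> f + g \<in> VP" "f \<in> VP \<Longrightarrow> - f \<in> VP"
  "f \<in> VP \<Longrightarrow> pCons 0 f \<in> VP"
  by (simp_all add: coeffs_in_def zero_in_sum add_in_sum neg_in_sum coeff_pCons split: nat.splits)

lemma UP_simps: "0 \<in> UP" "m \<in> UP \<Longrightarrow> n \<in> UP \<Longrightarrow> m + n \<in> UP" "m \<in> UP \<Longrightarrow> - m \<in> UP"
  "m \<in> UP \<Longrightarrow> pCons 0 m \<in> UP"
  by (simp_all add: coeffs_in_def U.zero_in_sum U.add_in_sum U.neg_in_sum coeff_pCons split: nat.splits)

lemma act_uminus: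
  assumes "f \<in> VP" "m \<in> UP"
  shows "act (- f) m = - act f m" "act f (- m) = - act f m"
  using act_add_left[OF assms(1) VP_simps(3)[OF assms(1)] assms(2)]
    act_add_right[OF assms UP_simps(3)[OF assms(2)]] act_0[OF assms(2)] act_right_0[OF assms(1)]
  by (simp_all add: eq_neg_iff_add_eq_0 add.commute)

text \<open>
  For \<open>S\<close> and \<open>T\<close> multiplication by \<open>\<lambda>\<close> and \<open>\<mu>\<close> this is \<open>\<rho>\<^sub>\<lambda>(f, \<rho>\<^sub>\<mu>(g, m))\<close>; exchanging \<open>S\<close> and
  \<open>T\<close> exchanges the roles of the variables.
\<close>

definition nested_act where
  "nested_act S T f g m = subst_poly T (\<lambda>y. eval_at S (act f y)) (act g m)"

context
  fixes S T :: "'u poly poly poly \<Rightarrow> 'u poly poly poly"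
  assumes S: "shift_op S" and T: "shift_op T" and ST: "\<And>q. S (T q) = T (S q)"
begin

lemma additive_ST: "additive S" "additive T"
  using S T by (simp_all add: shift_op_def)

lemma nested_act_add_1:
  assumes "f \<in> VP" "f' \<in> VP" "g \<in> VP" "m \<in> UP"
  shows "nested_act S T (f + f') g m = nested_act S T f g m + nested_act S T f' g m"
  unfolding nested_act_def
  by (rule subst_poly_fun_add[OF additive_ST(2), where G = UP])
    (use assms in \<open>simp_all add: act_right_0 eval_at_0 VP_simps act_add_left eval_at_add S act_in_sum\<close>)

lemma nested_act_add_2:
  assumes "f \<in> VP" "g \<in> VP" "g' \<in> VP" "m \<in> UP"
  shows "nested_act S T f (g + g') m = nested_act S T f g m + nested_act S T f g' m"
  unfolding nested_act_def act_add_left[OF assms(2-4)]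
  by (rule subst_poly_add[OF additive_ST(2), where G = UP])
    (use assms in \<open>simp_all add: act_right_0 eval_at_0 UP_simps act_add_right eval_at_add S act_in_sum\<close>)

lemma nested_act_add_3:
  assumes "f \<in> VP" "g \<in> VP" "m \<in> UP" "m' \<in> UP"
  shows "nested_act S T f g (m + m') = nested_act S T f g m + nested_act S T f g m'"
  unfolding nested_act_def act_add_right[OF assms(2-4)]
  by (rule subst_poly_add[OF additive_ST(2), where G = UP])
    (use assms in \<open>simp_all add: act_right_0 eval_at_0 UP_simps act_add_right eval_at_add S act_in_sum\<close>)

lemma nested_act_0:
  assumes "f \<in> VP" "g \<in> VP" "m \<in> UP"
  shows "nested_act S T 0 g m = 0" "nested_act S T f 0 m = 0" "nested_act S T f g 0 = 0"
  using nested_act_add_1[of 0 0 g m] nested_act_add_2[of f 0 0 m] nested_act_add_3[of f g 0 0] assms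
      VP_simps(1) UP_simps(1)
  by simp_all

lemma nested_act_D_1:
  assumes "f \<in> VP" "g \<in> VP" "m \<in> UP"
  shows "nested_act S T (pCons 0 f) g m = - S (nested_act S T f g m)"
  unfolding nested_act_def
  by (rule subst_poly_apply[OF additive_ST(2) additive_uminus[OF additive_ST(1)], where G = UP])
    (use assms in \<open>simp_all add: ST additive.minus[OF additive_ST(2)] act_right_0 eval_at_0 VP_simps act_D
       eval_at_neg_pCons[OF S, simplified] act_in_sum\<close>)

lemma nested_act_D_2:
  assumes "f \<in> VP" "g \<in> VP" "m \<in> UP"
  shows "nested_act S T f (pCons 0 g) m = - T (nested_act S T f g m)"
proof -
  have "subst_poly T (\<lambda>y. eval_at S (act f y)) (- pCons 0 (act g m))
    = - subst_poly T (\<lambda>y. eval_at S (act f y)) (pCons 0 (act g m))"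
    by (rule subst_poly_uminus[OF additive_ST(2), where G = UP])
      (use assms in \<open>simp_all add: act_right_0 eval_at_0 act_uminus additive.minus[OF
          additive_eval_at[OF S]] act_in_sum pCons_in_coeffs_in UP_simps\<close>)
  then show ?thesis
    unfolding nested_act_def act_D[OF assms(3)]
    using assms by (simp add: subst_poly_pCons[OF additive_ST(2)] act_right_0 eval_at_0)
qed

lemma nested_act_D_3:
  assumes "f \<in> VP" "g \<in> VP" "m \<in> UP"
  shows "nested_act S T f g (pCons 0 m) = mult_D (nested_act S T f g m) + S (nested_act S T f g m) +
      T (nested_act S T f g m)"
proof -
  let ?F = "\<lambda>y. eval_at S (act f y)"
  let ?D = "\<lambda>q. mult_D q + S q"
  have F0: "?F 0 = 0" using assms by (simp add: act_right_0 eval_at_0)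
  have "subst_poly T ?F (map_poly (pCons 0) (act g m)) = ?D (subst_poly T ?F (act g m))"
    by (rule subst_poly_intertwine[OF additive_ST(2) additive_plus[OF additive_mult_D
        additive_ST(1)], where G = UP])
      (use assms T F0 in \<open>simp_all add: ST additive.add[OF additive_ST(2)] act_right_D
          eval_at_mult_D_lambda[OF S] act_in_sum shift_op_def\<close>)
  moreover have "subst_poly T ?F (map_poly (pCons 0) (act g m) + pCons 0 (act g m))
    = subst_poly T ?F (map_poly (pCons 0) (act g m)) + subst_poly T ?F (pCons 0 (act g m))"
  proof (rule subst_poly_add[OF additive_ST(2), where G = UP])
    show "map_poly (pCons 0) (act g m) \<in> coeffs_in UP"
      using act_in_sum[OF assms(2,3)] by (simp add: coeffs_in_def[of UP] coeff_map_poly UP_simps)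
  qed (use assms in \<open>simp_all add: act_right_0 eval_at_0 UP_simps act_add_right eval_at_add S
      act_in_sum pCons_in_coeffs_in\<close>)
  ultimately show ?thesis
    unfolding nested_act_def act_right_D[OF assms(2,3)] mult_D_lambda_def
    using F0 by (simp add: subst_poly_pCons[OF additive_ST(2)])
qed

end

sublocale regular: novikov_bimodule scale V circ scale V circ opp
  by (rule regular_bimodule)

text \<open>
  The third term of the Jacobi identity, \<open>\<rho>\<^sub>\<lambda>\<^sub>+\<^sub>\<mu>([f\<^sub>\<lambda> g], m)\<close>.
\<close>

definition bracket_act where
  "bracket_act f g m = subst_poly mult_lambda (\<lambda>c. eval_at mult_lambda_mu (act c m)) (br f g)"

lemma bracket_act_0: assumes "f \<in> VP" "g \<in> VP" "m \<in> UP"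
  shows "bracket_act 0 g m = 0" "bracket_act f 0 m = 0" "bracket_act f g 0 = 0"
proof -
  show "bracket_act 0 g m = 0" "bracket_act f 0 m = 0"
    using assms by (simp_all add: bracket_act_def regular.act_0 regular.act_right_0 subst_poly_0
        act_0 eval_at_0)
  have "subst_poly mult_lambda (\<lambda>c. eval_at mult_lambda_mu (act c 0)) (br f g) =
     (\<lambda>_. 0) (subst_poly mult_lambda (\<lambda>c. eval_at mult_lambda_mu (act c m)) (br f g))"
    by (rule subst_poly_apply[OF additive_mult_lambda, where G = VP])
     (use assms in \<open>simp_all add: regular.act_in_sum act_right_0 VP_simps eval_at_0 act_0 UP_simps
         additive_def
       additive_zero[OF additive_mult_lambda]\<close>)
  then show "bracket_act f g 0 = 0" by (simp add: bracket_act_def)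
qed

lemma eval_bracket_add:
  assumes "p \<in> coeffs_in VP" "q \<in> coeffs_in VP" "m \<in> UP"
  shows "subst_poly mult_lambda (\<lambda>c. eval_at mult_lambda_mu (act c m)) (p + q) =
    subst_poly mult_lambda (\<lambda>c. eval_at mult_lambda_mu (act c m)) p +
    subst_poly mult_lambda (\<lambda>c. eval_at mult_lambda_mu (act c m)) q"
  by (rule subst_poly_add[OF additive_mult_lambda, where G = VP])
    (use assms in \<open>simp_all add: act_0 eval_at_0 VP_simps act_add_left eval_at_add
        shift_op_mult_lambda_mu\<close>)

lemma bracket_act_add:
  shows "\<lbrakk>f \<in> VP; f' \<in> VP; g \<in> VP; m \<in> UP\<rbrakk> \<Longrightarrow> bracket_act (f + f') g m = bracket_act f g m +
      bracket_act f' g m"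
    and "\<lbrakk>f \<in> VP; g \<in> VP; g' \<in> VP; m \<in> UP\<rbrakk> \<Longrightarrow> bracket_act f (g + g') m = bracket_act f g m +
        bracket_act f g' m"
    and "\<lbrakk>f \<in> VP; g \<in> VP; m \<in> UP; m' \<in> UP\<rbrakk> \<Longrightarrow> bracket_act f g (m + m') = bracket_act f g m +
        bracket_act f g m'"
  unfolding bracket_act_def
    apply (simp_all add: regular.act_add_left regular.act_add_right eval_bracket_add regular.act_in_sum)
  by (rule subst_poly_fun_add[OF additive_mult_lambda, where G = VP])
    (simp_all add: act_0 eval_at_0 UP_simps act_add_right eval_at_add shift_op_mult_lambda_mu
        regular.act_in_sum)

lemma bracket_act_D_1:
  assumes "f \<in> VP" "g \<in> VP" "m \<in> UP"
  shows "bracket_act (pCons 0 f) g m = - mult_lambda (bracket_act f g m)"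
proof -
  have F0: "eval_at mult_lambda_mu (act 0 m) = 0" by (simp add: assms act_0 eval_at_0)
  have "subst_poly mult_lambda (\<lambda>c. eval_at mult_lambda_mu (act c m)) (- pCons 0 (br f g))
    = - subst_poly mult_lambda (\<lambda>c. eval_at mult_lambda_mu (act c m)) (pCons 0 (br f g))"
    by (rule subst_poly_uminus[OF additive_mult_lambda, where G = VP])
      (use assms in \<open>simp_all add: F0 act_uminus additive.minus[OF additive_eval_at[OF
          shift_op_mult_lambda_mu]]
        regular.act_in_sum pCons_in_coeffs_in VP_simps\<close>)
  then show ?thesis
    unfolding bracket_act_def regular.act_D[OF assms(2)]
    using F0 by (simp add: subst_poly_pCons[OF additive_mult_lambda])
qed

text \<open>
  Moving \<open>\<partial>\<close> to the second argument of the bracket multiplies by \<open>\<partial> + \<lambda>\<close>, and \<open>\<partial>\<close> acts on the left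
  of \<open>\<rho>\<^sub>\<lambda>\<^sub>+\<^sub>\<mu>\<close> as \<open>-\<lambda> - \<mu>\<close>; what remains is \<open>-\<mu>\<close>, as for \<open>\<rho>\<^sub>\<lambda> \<rho>\<^sub>\<mu>\<close>.
\<close>

lemma bracket_act_D_2:
  assumes "f \<in> VP" "g \<in> VP" "m \<in> UP"
  shows "bracket_act f (pCons 0 g) m = - mult_mu (bracket_act f g m)"
proof -
  let ?F = "\<lambda>c. eval_at mult_lambda_mu (act c m)"
  have F0: "?F 0 = 0" by (simp add: assms act_0 eval_at_0)
  have "subst_poly mult_lambda ?F (map_poly (pCons 0) (br f g)) = - mult_lambda_mu (subst_poly
      mult_lambda ?F (br f g))"
    by (rule subst_poly_intertwine[OF additive_mult_lambda additive_uminus[OF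
        additive_mult_lambda_mu], where G = VP])
      (use assms F0 in \<open>simp_all add: mult_lambda_mu_mult_lambda act_D eval_at_neg_pCons[OF
          shift_op_mult_lambda_mu, simplified]
        regular.act_in_sum additive.minus[OF additive_mult_lambda]\<close>)
  moreover have "map_poly (pCons 0) (br f g) \<in> coeffs_in VP"
    using regular.act_in_sum[OF assms(1,2)] by (simp add: coeffs_in_def[of VP] coeff_map_poly VP_simps)
  then have "subst_poly mult_lambda ?F (map_poly (pCons 0) (br f g) + pCons 0 (br f g)) =
     subst_poly mult_lambda ?F (map_poly (pCons 0) (br f g)) + subst_poly mult_lambda ?F (pCons 0
         (br f g))"
    using assms by (intro eval_bracket_add) (simp_all add: pCons_in_coeffs_in VP_simps regular.act_in_sum)
  ultimately show ?thesis
    unfolding bracket_act_def regular.act_right_D[OF assms(1,2)] mult_D_lambda_def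
    using F0 by (simp add: subst_poly_pCons[OF additive_mult_lambda] mult_lambda_mu_def)
qed

lemma bracket_act_D_3:
  assumes "f \<in> VP" "g \<in> VP" "m \<in> UP"
  shows "bracket_act f g (pCons 0 m) = mult_D (bracket_act f g m) + mult_lambda (bracket_act f g m)
      + mult_mu (bracket_act f g m)"
proof -
  let ?D = "\<lambda>q. mult_D q + mult_lambda_mu q"
  have "subst_poly mult_lambda (\<lambda>c. eval_at mult_lambda_mu (act c (pCons 0 m))) (br f g)
     = ?D (subst_poly mult_lambda (\<lambda>c. eval_at mult_lambda_mu (act c m)) (br f g))"
    by (rule subst_poly_apply[OF additive_mult_lambda additive_plus[OF additive_mult_D
        additive_mult_lambda_mu], where G = VP])
      (use assms in \<open>simp_all add: mult_lambda_mu_mult_lambda mult_D_mult_lambda act_0 UP_simps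
          eval_at_0 additive.add[OF additive_mult_lambda] act_right_D
        eval_at_mult_D_lambda[OF shift_op_mult_lambda_mu] regular.act_in_sum\<close>)
  then show ?thesis by (simp add: bracket_act_def mult_lambda_mu_def add.assoc)
qed

definition jacobi_defect where
  "jacobi_defect i j f g m = nested_act mult_lambda mult_mu f g m - koszul i j (nested_act mult_mu
      mult_lambda g f m) - bracket_act f g m"

lemmas lambda_mu_ops = shift_op_mult_lambda shift_op_mult_mu mult_lambda_mu_commute
lemmas mu_lambda_ops = shift_op_mult_mu shift_op_mult_lambda mult_lambda_mu_commute[symmetric]

text \<open>
  The three terms transform alike under \<open>\<partial>\<close> in each argument. Hence the vanishing of the defect
  passes from \<open>f\<close> to \<open>\<partial> f\<close>, and similarly for the other two arguments.
\<close>

lemma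
  shows jacobi_defect_add_1: "\<lbrakk>f \<in> VP; f' \<in> VP; g \<in> VP; m \<in> UP\<rbrakk> \<Longrightarrow> jacobi_defect i j (f + f') g m =
      jacobi_defect i j f g m + jacobi_defect i j f' g m"
    and jacobi_defect_add_2: "\<lbrakk>f \<in> VP; g \<in> VP; g' \<in> VP; m \<in> UP\<rbrakk> \<Longrightarrow> jacobi_defect i j f (g + g') m =
        jacobi_defect i j f g m + jacobi_defect i j f g' m"
    and jacobi_defect_add_3: "\<lbrakk>f \<in> VP; g \<in> VP; m \<in> UP; m' \<in> UP\<rbrakk> \<Longrightarrow> jacobi_defect i j f g (m + m') =
        jacobi_defect i j f g m + jacobi_defect i j f g m'"
    and jacobi_defect_0: "\<lbrakk>f \<in> VP; g \<in> VP; m \<in> UP\<rbrakk> \<Longrightarrow> jacobi_defect i j 0 g m = 0"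
     "\<lbrakk>f \<in> VP; g \<in> VP; m \<in> UP\<rbrakk> \<Longrightarrow> jacobi_defect i j f 0 m = 0" "\<lbrakk>f \<in> VP; g \<in> VP; m \<in> UP\<rbrakk> \<Longrightarrow>
         jacobi_defect i j f g 0 = 0"
    and jacobi_defect_D_1: "\<lbrakk>f \<in> VP; g \<in> VP; m \<in> UP\<rbrakk> \<Longrightarrow> jacobi_defect i j (pCons 0 f) g m = -
        mult_lambda (jacobi_defect i j f g m)"
    and jacobi_defect_D_2: "\<lbrakk>f \<in> VP; g \<in> VP; m \<in> UP\<rbrakk> \<Longrightarrow> jacobi_defect i j f (pCons 0 g) m = - mult_mu
        (jacobi_defect i j f g m)"
    and jacobi_defect_D_3: "\<lbrakk>f \<in> VP; g \<in> VP; m \<in> UP\<rbrakk> \<Longrightarrow>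
      jacobi_defect i j f g (pCons 0 m) = mult_D (jacobi_defect i j f g m) + mult_lambda
          (jacobi_defect i j f g m) + mult_mu (jacobi_defect i j f g m)"
  unfolding jacobi_defect_def
  by (simp_all add: nested_act_add_1[OF lambda_mu_ops] nested_act_add_2[OF lambda_mu_ops]
      nested_act_add_3[OF lambda_mu_ops] nested_act_0[OF lambda_mu_ops] nested_act_D_1[OF lambda_mu_ops]
      nested_act_D_2[OF lambda_mu_ops] nested_act_D_3[OF lambda_mu_ops] nested_act_add_1[OF
          mu_lambda_ops] nested_act_add_2[OF mu_lambda_ops] nested_act_add_3[OF mu_lambda_ops]
          nested_act_0[OF mu_lambda_ops] nested_act_D_1[OF mu_lambda_ops]
      nested_act_D_2[OF mu_lambda_ops] nested_act_D_3[OF mu_lambda_ops] bracket_act_add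
          bracket_act_0 bracket_act_D_1 bracket_act_D_2 bracket_act_D_3
      koszul_add koszul_uminus koszul_0 additive_koszul additive_mult_lambda additive_mult_mu
          additive_mult_D
      additive.diff[OF additive_mult_lambda] additive.diff[OF additive_mult_mu] additive.diff[OF
          additive_mult_D]
      additive.add[OF additive_mult_lambda] additive.add[OF additive_mult_mu] additive.add[OF
          additive_mult_D]
      algebra_simps)

lemma const_in: "[:a:] \<in> coeffs_in G \<longleftrightarrow> a \<in> G \<and> 0 \<in> G"
  by (auto simp: coeffs_in_def coeff_pCons split: nat.splits)

lemma eval_at_gen:
  assumes "shift_op S"
  shows "eval_at S (gen a u) = const2 [:l a u - r a u, r a u:] + S (const2 [:l a u + r a u:])"
  using assms by (simp add: bimodule_generator_eq eval_at_pCons eval_at_0 additive_zero[OF shift_opD(1)])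

lemma eval_at_act_pair:
  assumes S: "shift_op S" and "a \<in> graded_sum V" "p \<in> graded_sum U" "q \<in> graded_sum U"
  shows "eval_at S (act [:a:] [:p, q:]) = eval_at S (gen a p) + mult_D (eval_at S (gen a q)) + S
      (eval_at S (gen a q))"
proof -
  have "[:p, q:] \<in> UP" using assms by (simp add: pCons_in_coeffs_in zero_in_coeffs_in U.zero_in_sum)
  then have "act [:a:] [:p, q:] = gen a p + MD (gen a q)"
    using assms by (simp add: act_pCons act_0 subst_poly_pCons[OF additive_MD] gen_simps
        subst_poly_0 additive_zero[OF additive_MD])
  then show ?thesis by (simp add: eval_at_add S eval_at_mult_D_lambda)
qed

lemma nested_act_const:
  assumes S: "shift_op S" and T: "shift_op T" and "a \<in> graded_sum V" "b \<in> graded_sum V" "u \<in> graded_sum U"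
  shows "nested_act S T [:a:] [:b:] [:u:] = eval_at S (gen a (l b u - r b u)) + mult_D (eval_at S
      (gen a (r b u)))
    + S (eval_at S (gen a (r b u))) + T (eval_at S (gen a (l b u + r b u)))"
proof -
  have F0: "eval_at S (act [:a:] 0) = 0"
    using assms by (simp add: act_right_0 const_in zero_in_sum eval_at_0)
  show ?thesis
    unfolding nested_act_def act_const[of b]
    using assms F0
    by (simp add: bimodule_generator_eq[of l r b] subst_poly_pCons[OF shift_opD(1)[OF T]] eval_at_act_pair
      act_const subst_poly_0 additive_zero[OF shift_opD(1)[OF T]] l_in r_in U.diff_in_sum)
qed

lemma bracket_act_const:
  assumes "a \<in> graded_sum V" "b \<in> graded_sum V" "u \<in> graded_sum U"
  shows "bracket_act [:a:] [:b:] [:u:] = eval_at mult_lambda_mu (gen (a \<bullet> b - opp a b) u)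
    - mult_lambda_mu (eval_at mult_lambda_mu (gen (opp a b) u)) + mult_lambda (eval_at
        mult_lambda_mu (gen (a \<bullet> b + opp a b) u))"
proof -
  have pair: "act [:p, q:] [:u:] = gen p u - pCons 0 (gen q u)" for p q
    using assms by (simp add: act_pCons const_in U.zero_in_sum act_0 subst_poly_const)
  have F0: "eval_at mult_lambda_mu (act 0 [:u:]) = 0"
    using assms by (simp add: act_0 const_in U.zero_in_sum eval_at_0)
  have pair': "eval_at mult_lambda_mu (act [:p, q:] [:u:])
      = eval_at mult_lambda_mu (gen p u) - mult_lambda_mu (eval_at mult_lambda_mu (gen q u))" for p q
    by (simp only: pair additive.diff[OF additive_eval_at[OF shift_op_mult_lambda_mu]]
       eval_at_pCons[OF shift_op_mult_lambda_mu] const2_0 add_0)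
  show ?thesis
    unfolding bracket_act_def regular.act_const
    using assms F0
    by (simp add: bimodule_generator_eq[of circ opp] subst_poly_pCons[OF additive_mult_lambda] pair'
        act_const subst_poly_0
       additive_zero[OF additive_mult_lambda])
qed

text \<open>
  Here the four bimodule relations enter. They are used as rewrite rules that leave only
  \<open>l (a \<bullet> b) u\<close>, \<open>r (a \<bullet> b) u\<close>, the same with \<open>a\<close> and \<open>b\<close> exchanged, \<open>r a (r b u)\<close> and
  \<open>l b (l a u)\<close>; in each coefficient these cancel.
\<close>

lemma jacobi_defect_const:
  assumes abu: "a \<in> V i" "b \<in> V j" "u \<in> U k"
  shows "jacobi_defect i j [:a:] [:b:] [:u:] = 0"
proof -
  note s = part_subset_sum[OF abu(1)] part_subset_sum[OF abu(2)] U.part_subset_sum[OF abu(3)]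
    part_subset_sum[OF circ_grade[OF abu(1,2)]] part_subset_sum[OF circ_grade[OF abu(2,1)]]
  have opp_ab: "opp a b = koszul i j (b \<bullet> a)" by (rule opp_homogeneous[OF abu(1,2)])
  have kin: "koszul i j v \<in> graded_sum V" if "v \<in> graded_sum V" for v
    using that by (simp add: koszul_def neg_in_sum)
  have lk: "l (koszul i j v) u = koszul i j (l v u)" "r (koszul i j v) u = koszul i j (r v u)"
    if "v \<in> graded_sum V" for v using that s by (simp_all add: koszul_def l_simps r_simps)
  note bim = r_r[OF abu] r_l[OF abu] r_l[OF abu(2,1,3)]
  have ll: "l a (l b u) = l (a \<bullet> b) u + koszul i j (l b (l a u)) - koszul i j (l (b \<bullet> a) u)"
    using l_l[OF abu] by (simp add: koszul_diff algebra_simps)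
  have lr: "l a (r b u) = l (a \<bullet> b) u + r (a \<bullet> b) u - r a (r b u)"
    using l_r[OF abu] by (simp add: algebra_simps)
  have lr': "l b (r a u) = l (b \<bullet> a) u + r (b \<bullet> a) u - r b (r a u)"
    using l_r[OF abu(2,1,3)] by (simp add: algebra_simps)
  show ?thesis
    unfolding jacobi_defect_def nested_act_const[OF shift_op_mult_lambda shift_op_mult_mu s(1-3)]
      nested_act_const[OF shift_op_mult_mu shift_op_mult_lambda s(2,1,3)] bracket_act_const[OF s(1-3)]
      eval_at_gen[OF shift_op_mult_lambda] eval_at_gen[OF shift_op_mult_mu] eval_at_gen[OF
          shift_op_mult_lambda_mu]
      opp_ab
    apply (simp add: l_simps r_simps s l_in r_in kin lk U.diff_in_sum ll lr lr' bim diff_in_sum)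
    apply (simp add: const2_def mult_lambda_mu_def mult_lambda_def mult_mu_def mult_D_def map_poly_pCons)
    apply (simp add: koszul_def algebra_simps)
    done
qed

lemma pCons_split: "pCons a f = [:a:] + pCons 0 (f :: 'x::ab_group_add poly)"
  by simp

lemma jacobi_defect_zero:
  assumes "f \<in> coeffs_in (V i)" "g \<in> coeffs_in (V j)" "m \<in> coeffs_in (U k)"
  shows "jacobi_defect i j f g m = 0"
proof -
  note c = const_in part_subset_sum U.part_subset_sum zero_in_sum U.zero_in_sum VP_simps UP_simps
  have V: "coeffs_in (V i') \<subseteq> VP" for i' using part_subset_sum unfolding coeffs_in_def by blast
  have U: "coeffs_in (U i') \<subseteq> UP" for i' using U.part_subset_sum unfolding coeffs_in_def by blast
  note z = additive_zero[OF additive_mult_lambda] additive_zero[OF additive_mult_mu]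
      additive_zero[OF additive_mult_D]
  \<comment> \<open>The defect vanishes first for constant \<open>f\<close> and \<open>g\<close>, then for constant \<open>f\<close>, then always.\<close>
  have 1: "jacobi_defect i j [:a:] [:b:] m = 0" if "a \<in> V i" "b \<in> V j" for a b
    using assms(3)
  proof (induction m rule: coeffs_in_induct)
    case 0
    then show ?case by (intro jacobi_defect_0(3)[where m = 0]) (use that in \<open>auto simp: c\<close>)
  next
    case (pCons u m)
    then have "m \<in> UP" using U by blast
    then show ?case unfolding pCons_split[of u m]
      by (subst jacobi_defect_add_3) (use pCons that in \<open>auto simp: c jacobi_defect_const
          jacobi_defect_D_3 z\<close>)
  qed
  note mUP = U[THEN subsetD, OF assms(3)]
  have 2: "jacobi_defect i j [:a:] g m = 0" if "a \<in> V i" for a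
    using assms(2)
  proof (induction g rule: coeffs_in_induct)
    case 0
    then show ?case by (intro jacobi_defect_0(2)[where f = "[:a:]" and g = 0]) (use that mUP in
        \<open>auto simp: c\<close>)
  next
    case (pCons b g)
    then have "g \<in> VP" using V by blast
    then show ?case unfolding pCons_split[of b g]
      by (subst jacobi_defect_add_2) (use pCons that mUP in \<open>auto simp: c 1 jacobi_defect_D_2 z\<close>)
  qed
  note gVP = V[THEN subsetD, OF assms(2)]
  show ?thesis using assms(1)
  proof (induction f rule: coeffs_in_induct)
    case 0
    then show ?case by (intro jacobi_defect_0(1)[where f = 0]) (use mUP gVP in \<open>auto simp: c\<close>)
  next
    case (pCons a f)
    then have "f \<in> VP" using V by blast
    then show ?case unfolding pCons_split[of a f]
      by (subst jacobi_defect_add_1) (use pCons gVP mUP in \<open>auto simp: c 2 jacobi_defect_D_1 z\<close>)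
  qed
qed

end

section \<open>Quadratic Lie conformal superalgebras and their representations\<close>

text \<open>
  The substitution \<open>\<lambda> \<mapsto> -\<partial> - \<lambda>\<close> of the skew-symmetry axiom. It exchanges multiplication by \<open>\<partial> + \<lambda>\<close>
  with multiplication by \<open>-\<lambda>\<close>, which is why skew-symmetry also needs to be checked on generators
  only.
\<close>

definition skew_subst :: "'c::ab_group_add poly poly \<Rightarrow> 'c poly poly" where
  "skew_subst p = subst_poly (\<lambda>q. - mult_D_lambda (pCons 0) q) (\<lambda>c. [:c:]) p"

lemma additive_mult_D_lambda_pCons: "additive (mult_D_lambda (pCons (0::'c::ab_group_add)))"
  by (intro additive_mult_D_lambda additive_pCons)

lemma skew_subst_pCons: "skew_subst (pCons c p) = [:c:] - mult_D_lambda (pCons 0) (skew_subst p)"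
  unfolding skew_subst_def
  by (subst subst_poly_pCons) (simp_all add: additive_uminus additive_mult_D_lambda_pCons)

lemma skew_subst_0: "skew_subst 0 = 0"
  by (simp add: skew_subst_def subst_poly_0)

lemma additive_skew_subst: "additive skew_subst"
  unfolding additive_def skew_subst_def
  by (intro allI subst_poly_add[where G = UNIV])
    (simp_all add: additive_uminus additive_mult_D_lambda_pCons coeffs_in_def)

lemma skew_subst_mult_D_lambda:
  fixes p :: "'a::ab_group_add poly poly"
  shows "skew_subst (mult_D_lambda (pCons 0) p) = - pCons 0 (skew_subst p)"
proof -
  note D = additive_map_poly[OF additive_pCons]
  have "map_poly (pCons 0) (- mult_D_lambda (pCons 0) q) = - mult_D_lambda (pCons 0) (map_poly
      (pCons 0) q)"
    for q :: "'a poly poly"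
    by (simp only: mult_D_lambda_def additive.minus[OF D] additive.add[OF D] map_poly_pCons pCons_0_0)
  then have "skew_subst (map_poly (pCons 0) p) = map_poly (pCons 0) (skew_subst p)"
    unfolding skew_subst_def
    by (intro subst_poly_intertwine[where G = UNIV])
      (simp_all only: additive_uminus additive_mult_D_lambda_pCons D coeffs_in_def pCons_0_0
        map_poly_pCons map_poly_0, simp_all)
  then show ?thesis
    by (simp add: mult_D_lambda_def[of _ p] additive.add[OF additive_skew_subst] skew_subst_pCons)
      (simp add: mult_D_lambda_def)
qed

context novikov_superalgebra
begin

lemma br_skew:
  assumes "f \<in> coeffs_in (V i)" "g \<in> coeffs_in (V j)"
  shows "br f g = - koszul i j (skew_subst (br g f))"
proof -
  interpret R: novikov_bimodule scale V circ scale V circ opp by (rule regular_bimodule)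
  \<comment> \<open>The defect of skew-symmetry; like the Jacobi defect it is sesqui-linear.\<close>
  define K where "K f g = br f g + koszul i j (skew_subst (br g f))" for f g
  note add_sk = additive.add[OF additive_skew_subst] additive.minus[OF additive_skew_subst]
  have K_add: "K (f + f') g = K f g + K f' g" "K g (f + f') = K g f + K g f'"
    if "f \<in> R.VP" "f' \<in> R.VP" "g \<in> R.VP" for f f' g
    using that by (simp_all add: K_def R.act_add_left R.act_add_right add_sk koszul_add algebra_simps)
  have K_D1: "K (pCons 0 f) g = - pCons 0 (K f g)" if "f \<in> R.VP" "g \<in> R.VP" for f g
    using that by (simp add: K_def R.act_D R.act_right_D skew_subst_mult_D_lambda koszul_uminus
        additive.minus[OF additive_skew_subst]
        additive_koszul[OF additive_pCons])
  have K_D2: "K f (pCons 0 g) = R.MD (K f g)" if "f \<in> R.VP" "g \<in> R.VP" for f g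
    using that by (simp only: K_def R.act_D R.act_right_D skew_subst_pCons add_sk pCons_0_0 diff_0
        minus_minus
        additive_koszul[OF additive_mult_D_lambda_pCons] additive.add[OF additive_mult_D_lambda_pCons])
  have K_const: "K [:a:] [:b:] = 0" if "a \<in> V i" "b \<in> V j" for a b
    by (cases i; cases j)
      (simp_all add: K_def R.act_const bimodule_generator_eq skew_subst_pCons skew_subst_0
          additive_zero[OF additive_mult_D_lambda_pCons]
        opp_homogeneous[OF that] opp_homogeneous[OF that(2,1)] koszul_def mult_D_lambda_def
            map_poly_pCons)
  have VP: "coeffs_in (V k) \<subseteq> R.VP" for k
    using part_subset_sum unfolding coeffs_in_def by blast
  have K0: "K 0 g = 0" "K g 0 = 0" if "g \<in> R.VP" for g
    using K_add[of 0 0 g] that R.VP_simps by simp_all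
  have 1: "K [:a:] g = 0" if "a \<in> V i" for a
    using assms(2)
  proof (induction g rule: coeffs_in_induct)
    case 0
    then show ?case by (rule K0) (use that in \<open>auto simp: R.const_in part_subset_sum zero_in_sum\<close>)
  next
    case (pCons b g)
    then have "g \<in> R.VP" using VP by blast
    then show ?case unfolding R.pCons_split[of b g]
      by (subst K_add) (use pCons that in \<open>auto simp: K_const K_D2 R.VP_simps
         additive_zero[OF additive_mult_D_lambda_pCons] R.const_in part_subset_sum zero_in_sum\<close>)
  qed
  have "K f g = 0"
    using assms(1)
  proof (induction f rule: coeffs_in_induct)
    case 0
    then show ?case using VP assms(2) by (intro K0) auto
  next
    case (pCons a f)
    then have "f \<in> R.VP" "g \<in> R.VP" using VP assms(2) by blast+
    then show ?case unfolding R.pCons_split[of a f]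
      by (subst K_add) (use pCons in \<open>auto simp: 1 K_D1 R.VP_simps R.const_in part_subset_sum
          zero_in_sum\<close>)
  qed
  then show ?thesis by (simp add: K_def eq_neg_iff_add_eq_0)
qed

theorem lie_conformal_quadratic:
  "lie_conformal_superalgebra (poly_scale scale) (poly_grade V) (pCons 0)
     (quadratic_bracket V circ comm)"
  unfolding quadratic_bracket_eq
proof -
  interpret R: novikov_bimodule scale V circ scale V circ opp by (rule regular_bimodule)
  interpret H: graded_H_module "poly_scale scale" "poly_grade V" "pCons 0"
    by (rule graded_H_module_poly[OF superspace_axioms])
  have VP: "x \<in> R.VP" if "x \<in> poly_grade V i" for x i
    using that part_subset_sum unfolding poly_grade_def coeffs_in_def by blast
  show "lie_conformal_superalgebra (poly_scale scale) (poly_grade V) (pCons 0) br"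
  proof unfold_locales
    show "even_bilinear (poly_scale scale) (poly_grade V) (poly_scale scale) (poly_grade V)
      (poly_scale (poly_scale scale)) (poly_grade (poly_grade V)) br" by (rule R.act_bilinear)
  next
    fix x y i j assume x: "x \<in> poly_grade V i" and y: "y \<in> poly_grade V j"
    show "br (pCons 0 x) y = - pCons 0 (br x y)" by (rule R.act_D[OF VP[OF y]])
    show "br x (pCons 0 y) = mult_D_lambda (pCons 0) (br x y)" by (rule R.act_right_D[OF VP[OF x]
        VP[OF y]])
    show "br x y = - koszul i j (subst_poly (\<lambda>q. - mult_D_lambda (pCons 0) q) (\<lambda>c. [:c:]) (br y x))"
      using br_skew x y unfolding poly_grade_eq skew_subst_def by blast
    fix z k assume z: "z \<in> poly_grade V k"
    show "subst_poly mult_mu (\<lambda>c. subst_poly mult_lambda const2 (br x c)) (br y z)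
      - koszul i j (subst_poly mult_lambda (\<lambda>c. subst_poly mult_mu const2 (br y c)) (br x z))
      = subst_poly mult_lambda (\<lambda>c. subst_poly mult_lambda_mu const2 (br c z)) (br x y)"
      using R.jacobi_defect_zero[of x i y j z k] x y z
      unfolding R.jacobi_defect_def R.nested_act_def R.bracket_act_def eval_at_def poly_grade_eq by
          (simp add: eq_diff_eq)
  qed
qed

end

context novikov_bimodule
begin

theorem representation_act:
  "lie_conformal_representation (poly_scale scale) (poly_grade V) (pCons 0)
     (quadratic_bracket V circ comm) (poly_scale scaleU) (poly_grade U) (pCons 0) act"
proof -
  interpret L: lie_conformal_superalgebra "poly_scale scale" "poly_grade V" "pCons 0"
      "quadratic_bracket V circ comm"
    by (rule lie_conformal_quadratic)
  interpret H: graded_H_module "poly_scale scaleU" "poly_grade U" "pCons 0"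
    by (rule graded_H_module_poly[OF U.superspace_axioms])
  have VP: "x \<in> VP" if "x \<in> poly_grade V i" for x i
    using that part_subset_sum unfolding poly_grade_def coeffs_in_def by blast
  have UP: "x \<in> UP" if "x \<in> poly_grade U i" for x i
    using that U.part_subset_sum unfolding poly_grade_def coeffs_in_def by blast
  show ?thesis
  proof unfold_locales
    show "even_bilinear (poly_scale scale) (poly_grade V) (poly_scale scaleU) (poly_grade U)
      (poly_scale (poly_scale scaleU)) (poly_grade (poly_grade U)) act" by (rule act_bilinear)
  next
    fix a x i j assume x: "a \<in> poly_grade V i" and y: "x \<in> poly_grade U j"
    show "act (pCons 0 a) x = - pCons 0 (act a x)" by (rule act_D[OF UP[OF y]])
    show "act a (pCons 0 x) = mult_D_lambda (pCons 0) (act a x)" by (rule act_right_D[OF VP[OF x]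
        UP[OF y]])
  next
    fix x y i j z k assume x: "x \<in> poly_grade V i" and y: "y \<in> poly_grade V j" and z: "z \<in> poly_grade U k"
    show "subst_poly mult_mu (\<lambda>c. subst_poly mult_lambda const2 (act x c)) (act y z)
      - koszul i j (subst_poly mult_lambda (\<lambda>c. subst_poly mult_mu const2 (act y c)) (act x z))
      = subst_poly mult_lambda (\<lambda>c. subst_poly mult_lambda_mu const2 (act c z)) (quadratic_bracket V
          circ comm x y)"
      using jacobi_defect_zero[of x i y j z k] x y z
      unfolding jacobi_defect_def nested_act_def bracket_act_def eval_at_def poly_grade_eq
          quadratic_bracket_eq by (simp add: eq_diff_eq)
  qed
qed

text \<open>
  If \<open>f = a + \<partial> f\<^sub>1\<close>, then \<open>\<rho>\<^sub>\<lambda>(f, u) = \<rho>\<^sub>\<lambda>(a, u) - \<lambda> \<rho>\<^sub>\<lambda>(f\<^sub>1, u)\<close>, whose part of degree \<open>0\<close> in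
  \<open>\<lambda>\<close> is \<open>(l a u - r a u) + \<partial> (r a u)\<close>. So \<open>\<rho>\<^sub>\<lambda>(f, u) = 0\<close> forces \<open>l a u = 0\<close>, hence \<open>a = 0\<close>, and
  one continues with \<open>f\<^sub>1\<close>.
\<close>

lemma act_faithful:
  assumes u: "u \<in> graded_sum U" and inj: "\<And>a. a \<in> graded_sum V \<Longrightarrow> l a u = 0 \<Longrightarrow> a = 0"
    and f: "f \<in> VP" and 0: "act f [:u:] = 0"
  shows "f = 0"
  using f 0
proof (induction f rule: coeffs_in_induct)
  case 0
  show ?case ..
next
  case (pCons a f)
  have "[:u:] \<in> UP" using u by (simp add: const_in U.zero_in_sum)
  then have "gen a u = pCons 0 (act f [:u:])"
    using pCons.prems by (simp add: act_pCons subst_poly_const)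
  then have *: "[:l a u - r a u, r a u:] = 0" "[:[:l a u + r a u:]:] = act f [:u:]"
    by (simp_all only: bimodule_generator_eq pCons_eq_iff)
  from *(1) have "l a u = 0" "r a u = 0" by simp_all
  moreover from this have "act f [:u:] = 0" unfolding *(2)[symmetric] by simp
  ultimately show ?case using pCons inj by simp
qed

theorem finite_faithful:
  assumes "U.fin_dim" "u \<in> U i" and "\<And>a. a \<in> graded_sum V \<Longrightarrow> l a u = 0 \<Longrightarrow> a = 0"
  shows "finite_representation (poly_scale scale) (poly_grade V) (pCons 0)
     (quadratic_bracket V circ comm) scaleU U act"
   "lie_conformal_representation.faithful (poly_grade V) (poly_grade U) act"
proof -
  interpret M: lie_conformal_representation "poly_scale scale" "poly_grade V" "pCons 0"
     "quadratic_bracket V circ comm" "poly_scale scaleU" "poly_grade U" "pCons 0" act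
    by (rule representation_act)
  show "finite_representation (poly_scale scale) (poly_grade V) (pCons 0)
     (quadratic_bracket V circ comm) scaleU U act"
    by unfold_locales (rule assms(1))
  have u: "[:u:] \<in> graded_sum (poly_grade U)"
    by (rule M.M.part_subset_sum[of _ i])
     (use assms(2) in \<open>simp add: poly_grade_eq const_in U.zero_in\<close>)
  show M.faithful
    unfolding M.faithful_def
  proof (intro ballI impI)
    fix f assume f: "f \<in> graded_sum (poly_grade V)" and 0: "\<forall>x\<in>graded_sum (poly_grade U). act f x = 0"
    show "f = 0"
      using act_faithful[OF U.part_subset_sum[OF assms(2)] assms(3)] graded_sum_poly_grade[OF f] 0 u
          by blast
  qed
qed

end

section \<open>Adjoining a vector that no element annihilates\<close>

lemma koszul_apply: "koszul i j f v = koszul i j (f v)"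
  by (simp add: koszul_def)

lemma koszul_Pair: "koszul i j (x, y) = (koszul i j x, koszul i j y)"
  by (simp add: koszul_def)

lemma koszul_plus_left: "koszul (i + j) k x = koszul i k (koszul j k x)"
  by (cases i; cases j; cases k) (simp_all add: koszul_def)

lemma koszul_plus_right: "koszul k (i + j) x = koszul k i (koszul k j x)"
  by (cases i; cases j; cases k) (simp_all add: koszul_def)

context novikov_superalgebra
begin

text \<open>
  The value \<open>0\<close> off \<open>graded_sum V\<close> makes a map determined by its restriction to \<open>V\<close>, so that for
  finite-dimensional \<open>V\<close> finitely many coordinates determine it.
\<close>

definition linear_maps :: "('v \<Rightarrow> 'v) set" where
  "linear_maps = {q. (\<forall>x\<in>graded_sum V. \<forall>y\<in>graded_sum V. q (x + y) = q x + q y)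
     \<and> (\<forall>c. \<forall>x\<in>graded_sum V. q (scale c x) = scale c (q x))
     \<and> (\<forall>x\<in>graded_sum V. q x \<in> graded_sum V) \<and> (\<forall>x. x \<notin> graded_sum V \<longrightarrow> q x = 0)}"

text \<open>
  A map \<open>q\<close> of parity \<open>i\<close> stands for right multiplication \<open>v \<mapsto> v q\<close>; the last condition is then
  \<open>v b' q = \<plusminus> v q b'\<close>.
\<close>

definition right_endos :: "bit \<Rightarrow> ('v \<Rightarrow> 'v) set" where
  "right_endos i = {q \<in> linear_maps. (\<forall>j. \<forall>v\<in>V j. q v \<in> V (i + j))
     \<and> (\<forall>j k. \<forall>v\<in>V j. \<forall>b\<in>V k. q (v \<bullet> b) = koszul i k (q v \<bullet> b))}"

definition scale_map :: "'k \<Rightarrow> ('v \<Rightarrow> 'v) \<Rightarrow> 'v \<Rightarrow> 'v" where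
  "scale_map c q = (\<lambda>v. scale c (q v))"

lemma scale_map_apply: "scale_map c q v = scale c (q v)"
  by (simp add: scale_map_def)

lemma linear_mapsD:
  assumes "q \<in> linear_maps"
  shows "\<lbrakk>x \<in> graded_sum V; y \<in> graded_sum V\<rbrakk> \<Longrightarrow> q (x + y) = q x + q y"
    and "x \<in> graded_sum V \<Longrightarrow> q (scale c x) = scale c (q x)"
    and "x \<in> graded_sum V \<Longrightarrow> q x \<in> graded_sum V"
    and "x \<notin> graded_sum V \<Longrightarrow> q x = 0"
    and "q 0 = 0"
    and "x \<in> graded_sum V \<Longrightarrow> q (- x) = - q x"
    and "\<lbrakk>x \<in> graded_sum V; y \<in> graded_sum V\<rbrakk> \<Longrightarrow> q (x - y) = q x - q y"
proof -
  show add: "\<lbrakk>x \<in> graded_sum V; y \<in> graded_sum V\<rbrakk> \<Longrightarrow> q (x + y) = q x + q y"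
    and sc: "x \<in> graded_sum V \<Longrightarrow> q (scale c x) = scale c (q x)"
    and "x \<in> graded_sum V \<Longrightarrow> q x \<in> graded_sum V"
    and "x \<notin> graded_sum V \<Longrightarrow> q x = 0" for x y c
    using assms unfolding linear_maps_def by blast+
  show "q 0 = 0" using sc[of 0 0] zero_in_sum by simp
  show neg: "x \<in> graded_sum V \<Longrightarrow> q (- x) = - q x" for x using sc[of x "-1"] by simp
  show "\<lbrakk>x \<in> graded_sum V; y \<in> graded_sum V\<rbrakk> \<Longrightarrow> q (x - y) = q x - q y" for x y
    using add[of x "- y"] neg[of y] neg_in_sum by simp
qed

lemma linear_maps_closed:
  assumes p: "p \<in> linear_maps"
  shows "q \<in> linear_maps \<Longrightarrow> p + q \<in> linear_maps" "q \<in> linear_maps \<Longrightarrow> p - q \<in> linear_maps"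
    and "koszul i j p \<in> linear_maps" "scale_map c p \<in> linear_maps"
proof -
  have s: "scale_map c p \<in> linear_maps" if "p \<in> linear_maps" for c p
    using linear_mapsD[OF that] unfolding linear_maps_def scale_map_def
    by (auto simp: scale_right_distrib scale_in_sum mult.commute)
  have a: "p + q \<in> linear_maps" if "p \<in> linear_maps" "q \<in> linear_maps" for p q
    using linear_mapsD[OF that(1)] linear_mapsD[OF that(2)] unfolding linear_maps_def
    by (auto simp: scale_right_distrib add_in_sum algebra_simps)
  have "scale_map (-1) p = - p" for p
    by (rule ext) (simp add: scale_map_def)
  then have n: "- p \<in> linear_maps" if "p \<in> linear_maps" for p
    using s[OF that, of "-1"] by simp
  show "p + q \<in> linear_maps" "p - q \<in> linear_maps" if q: "q \<in> linear_maps"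
    using a[OF p q] a[OF p n[OF q]] by simp_all
  show "scale_map c p \<in> linear_maps" "koszul i j p \<in> linear_maps"
    using p s n by (simp_all add: koszul_def)
qed

lemma linear_maps_eqI:
  assumes "p \<in> linear_maps" "q \<in> linear_maps" and eq: "\<And>v j. v \<in> V j \<Longrightarrow> p v = q v"
  shows "p = q"
proof
  fix v
  show "p v = q v"
  proof (cases "v \<in> graded_sum V")
    case True
    then obtain a b where "a \<in> V 0" "b \<in> V 1" "v = a + b" by (rule graded_sum_cases)
    then show ?thesis
      using linear_mapsD(1)[OF assms(1)] linear_mapsD(1)[OF assms(2)] eq part_subset_sum by metis
  next
    case False
    then show ?thesis using linear_mapsD(4)[OF assms(1)] linear_mapsD(4)[OF assms(2)] by simp
  qed
qed

lemma right_endosD: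
  assumes "q \<in> right_endos i"
  shows "q \<in> linear_maps" "v \<in> V j \<Longrightarrow> q v \<in> V (i + j)"
    "\<lbrakk>v \<in> V j; b \<in> V k\<rbrakk> \<Longrightarrow> q (v \<bullet> b) = koszul i k (q v \<bullet> b)"
  using assms unfolding right_endos_def by blast+

lemma right_endosI:
  assumes "q \<in> linear_maps" "\<And>v j. v \<in> V j \<Longrightarrow> q v \<in> V (i + j)"
    "\<And>v b j k. \<lbrakk>v \<in> V j; b \<in> V k\<rbrakk> \<Longrightarrow> q (v \<bullet> b) = koszul i k (q v \<bullet> b)"
  shows "q \<in> right_endos i"
  using assms unfolding right_endos_def by blast

lemma superspace_right_endos: "superspace scale_map right_endos"
proof -
  interpret F: vector_space scale_map
    by unfold_locales (auto simp: scale_map_def scale_right_distrib scale_left_distrib)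
  show ?thesis
  proof unfold_locales
    fix i
    have Z: "(0 :: 'v \<Rightarrow> 'v) \<in> right_endos i"
    proof -
      have z: "0 \<bullet> b = 0" if "b \<in> V k" for b k
        using circ_scale_left[of b b 0] part_subset_sum[OF that] by simp
      show ?thesis
      by (auto simp: right_endos_def linear_maps_def zero_in zero_in_sum koszul_def z)
    qed
    have A: "p + q \<in> right_endos i" if p: "p \<in> right_endos i" and q: "q \<in> right_endos i" for p q
    proof -
      note pq = right_endosD[OF p] right_endosD[OF q]
      have "(p + q) v \<in> V (i + j)" if "v \<in> V j" for v j
        using pq(2,5)[OF that] subspace_add[OF subspace_part] by simp
      moreover have "(p + q) (v \<bullet> b) = koszul i k ((p + q) v \<bullet> b)" if "v \<in> V j" "b \<in> V k" for v b j k
        using pq(3,6)[OF that] part_subset_sum that pq(2,5)[OF that(1)]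
        by (simp add: koszul_add circ_add_left del: add_bit_eq_xor)
      ultimately show ?thesis
        by (intro right_endosI linear_maps_closed(1) pq(1,4))
    qed
    have S: "scale_map c p \<in> right_endos i" if p: "p \<in> right_endos i" for p c
    proof -
      note pq = right_endosD[OF p]
      have "(scale_map c p) v \<in> V (i + j)" if "v \<in> V j" for v j
        using pq(2)[OF that] subspace_scale[OF subspace_part] by (simp add: scale_map_def)
      moreover have "(scale_map c p) (v \<bullet> b) = koszul i k ((scale_map c p) v \<bullet> b)" if "v \<in> V j" "b \<in>
          V k" for v b j k
        using pq(3)[OF that] part_subset_sum that pq(2)[OF that(1)]
        by (simp add: scale_map_def koszul_def circ_scale_left del: add_bit_eq_xor)
      ultimately show ?thesis
        by (intro right_endosI linear_maps_closed(4)[OF pq(1)])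
    qed
    show "F.subspace (right_endos i)"
      unfolding F.subspace_def using Z A S by blast
  next
    show "right_endos 0 \<inter> right_endos 1 = {0}"
    proof (intro equalityI subsetI)
      fix q assume q: "q \<in> right_endos 0 \<inter> right_endos 1"
      have "q = 0"
      proof (rule linear_maps_eqI)
        show "q \<in> linear_maps" using q right_endosD by blast
        show "0 \<in> linear_maps" by (simp add: linear_maps_def zero_in_sum)
        fix v j assume v: "v \<in> V j"
        have "q v \<in> V (0 + j)" "q v \<in> V (1 + j)" using q right_endosD(2)[OF _ v] by blast+
        then have "q v \<in> V 0 \<inter> V 1" by (cases j) auto
        then show "q v = 0 v" using direct by simp
      qed
      then show "q \<in> {0}" by simp
    next
      fix q :: "'v \<Rightarrow> 'v" assume "q \<in> {0}"
      moreover have z: "0 \<bullet> b = 0" if "b \<in> V k" for b k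
        using circ_scale_left[of b b 0] part_subset_sum[OF that] by simp
      ultimately show "q \<in> right_endos 0 \<inter> right_endos 1"
        by (auto simp: right_endos_def linear_maps_def zero_in zero_in_sum koszul_def z)
    qed
  qed
qed

text \<open>
  The pair \<open>(q, w)\<close> stands for \<open>x q + w\<close> with \<open>x\<close> even and \<open>x' = 1\<close>.
\<close>

definition ext_module :: "bit \<Rightarrow> (('v \<Rightarrow> 'v) \<times> 'v) set" where "ext_module i = right_endos i \<times> V i"

definition ext_scale :: "'k \<Rightarrow> ('v \<Rightarrow> 'v) \<times> 'v \<Rightarrow> ('v \<Rightarrow> 'v) \<times> 'v" where
  "ext_scale c p = (scale_map c (fst p), scale c (snd p))"

text \<open>
  This is \<open>a q'\<close>: on homogeneous elements \<open>v a q' = \<plusminus> a v q' = \<plusminus> (a (v q)' - a v' q)\<close>. The sum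
  over parities extends the formula bilinearly.
\<close>

definition endo_left :: "'v \<Rightarrow> ('v \<Rightarrow> 'v) \<Rightarrow> 'v \<Rightarrow> 'v" where
  "endo_left a q v = (if v \<in> graded_sum V then
     \<Sum>i\<in>UNIV. \<Sum>j\<in>UNIV. koszul i j
       (component V i a \<bullet> q (component V j v) - q (component V i a \<bullet> component V j v)) else 0)"

text \<open>
  This is \<open>a' q\<close>, as \<open>v a' q = (v \<circ> a) q\<close>.
\<close>

definition endo_right :: "'v \<Rightarrow> ('v \<Rightarrow> 'v) \<Rightarrow> 'v \<Rightarrow> 'v" where
  "endo_right a q v = (if v \<in> graded_sum V then q (v \<bullet> a) else 0)"

text \<open>
  The summand \<open>q(a)\<close> comes from \<open>a (x q)' = x (a q') + a q\<close>.
\<close>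

definition ext_left where "ext_left a p = (endo_left a (fst p), a \<bullet> snd p + fst p a)"
definition ext_right where "ext_right a p = (endo_right a (fst p), opp a (snd p))"

lemma superspace_ext_module: "superspace ext_scale ext_module"
proof -
  interpret Q: superspace scale_map right_endos by (rule superspace_right_endos)
  interpret F: vector_space ext_scale
    by unfold_locales (auto simp: ext_scale_def Q.scale_right_distrib Q.scale_left_distrib
       scale_right_distrib scale_left_distrib)
  show ?thesis
  proof unfold_locales
    show "F.subspace (ext_module i)" for i
      using Q.subspace_part[of i] subspace_part[of i]
      unfolding F.subspace_def Q.subspace_def subspace_def
      by (auto simp: ext_module_def ext_scale_def zero_prod_def)
    show "ext_module 0 \<inter> ext_module 1 = {0}"
      using Q.direct direct unfolding ext_module_def zero_prod_def by blast
  qed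
qed

lemma ext_module_sumD:
  assumes "p \<in> graded_sum ext_module" shows "fst p \<in> linear_maps" "snd p \<in> graded_sum V"
proof -
  obtain a b where "a \<in> ext_module 0" "b \<in> ext_module 1" "p = a + b"
    using assms unfolding graded_sum_def by blast
  then show "fst p \<in> linear_maps" "snd p \<in> graded_sum V"
    using right_endosD(1) linear_maps_closed(1) unfolding graded_sum_def ext_module_def by force+
qed

lemma circ_zero: "x \<in> graded_sum V \<Longrightarrow> 0 \<bullet> x = 0" "x \<in> graded_sum V \<Longrightarrow> x \<bullet> 0 = 0"
  using even_bilinear_zero[OF circ_bilinear superspace_axioms superspace_axioms] by blast+

lemma circ_in: "\<lbrakk>x \<in> graded_sum V; y \<in> graded_sum V\<rbrakk> \<Longrightarrow> x \<bullet> y \<in> graded_sum V"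
  by (rule even_bilinear_in_sum[OF circ_bilinear superspace_axioms superspace_axioms superspace_axioms])

lemma component_in_sum: "x \<in> graded_sum V \<Longrightarrow> component V i x \<in> graded_sum V"
  using component_in part_subset_sum by blast

lemmas sum_simps = circ_in component_in_sum add_in_sum scale_in_sum

lemma endo_left_homogeneous:
  assumes "q \<in> linear_maps" "a \<in> V i" "v \<in> V j"
  shows "endo_left a q v = koszul i j (a \<bullet> q v - q (a \<bullet> v))"
  using part_subset_sum[OF assms(2)] part_subset_sum[OF assms(3)] linear_mapsD[OF assms(1)]
  unfolding endo_left_def UNIV_bit_eq
  by (cases i; cases j) (simp_all add: component_homogeneous[OF assms(2)] component_homogeneous[OF
      assms(3)]
    circ_zero zero_in_sum koszul_0)

lemma endo_left_linear:
  assumes "a \<in> graded_sum V" "q \<in> linear_maps"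
  shows "endo_left a q \<in> linear_maps"
  unfolding linear_maps_def
proof (intro CollectI conjI ballI allI impI)
  note q = linear_mapsD[OF assms(2)]
  show "endo_left a q (x + y) = endo_left a q x + endo_left a q y" if "x \<in> graded_sum V" "y \<in>
      graded_sum V" for x y
    using that assms(1) unfolding endo_left_def UNIV_bit_eq
    by (simp add: component_add q circ_add_right sum_simps koszul_def)
  show "endo_left a q (scale c x) = scale c (endo_left a q x)" if "x \<in> graded_sum V" for c x
    using that assms(1) unfolding endo_left_def UNIV_bit_eq
    by (simp add: component_scale q circ_scale_right sum_simps koszul_def scale_right_distrib
        scale_right_diff_distrib)
  show "endo_left a q x \<in> graded_sum V" if "x \<in> graded_sum V" for x
    using that assms(1) unfolding endo_left_def UNIV_bit_eq
    by (simp add: q sum_simps koszul_def diff_in_sum)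
  show "endo_left a q x = 0" if "x \<notin> graded_sum V" for x
    using that by (simp add: endo_left_def)
qed

lemma endo_right_linear:
  assumes "a \<in> graded_sum V" "q \<in> linear_maps"
  shows "endo_right a q \<in> linear_maps"
  using linear_mapsD[OF assms(2)] assms(1)
  by (auto simp: linear_maps_def endo_right_def sum_simps circ_add_left circ_scale_left)

lemma endo_right_homogeneous: "v \<in> V j \<Longrightarrow> endo_right a q v = q (v \<bullet> a)"
  by (simp add: endo_right_def part_subset_sum)

lemma koszul_in: "v \<in> V p \<Longrightarrow> koszul i j v \<in> V p"
  by (simp add: koszul_def subspace_neg[OF subspace_part])

text \<open>
  The point is that \<open>q\<close> respects associators with its argument in the middle,
  \<open>q (a, v, b) = \<plusminus> (a, q v, b)\<close>. By left symmetry the middle entry can be moved to the front, and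
  \<open>q\<close> passes over products whose left factor is its argument.
\<close>

lemma endo_left_in:
  assumes a: "a \<in> V i" and q: "q \<in> right_endos k"
  shows "endo_left a q \<in> right_endos (i + k)"
proof -
  note Q = right_endosD[OF q] and L = linear_mapsD[OF right_endosD(1)[OF q]]
  have "endo_left a q v \<in> V (i + k + j)" if v: "v \<in> V j" for v j
  proof -
    have "a \<bullet> q v \<in> V (i + k + j)" "q (a \<bullet> v) \<in> V (i + k + j)"
      using circ_grade[OF a Q(2)[OF v]] Q(2)[OF circ_grade[OF a v]] by (metis add.assoc add.commute)+
    then show ?thesis
      by (simp only: endo_left_homogeneous[OF Q(1) a v] koszul_in subspace_diff[OF subspace_part])
  qed
  moreover have "endo_left a q (v \<bullet> b) = koszul (i + k) m (endo_left a q v \<bullet> b)" if v: "v \<in> V j" and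
      b: "b \<in> V m" for v b j m
  proof -
    note g = circ_grade[OF a v] circ_grade[OF v b] circ_grade[OF v a] circ_grade[OF a b]
      circ_grade[OF a circ_grade[OF v b]] circ_grade[OF v circ_grade[OF a b]]
      circ_grade[OF circ_grade[OF a v] b] circ_grade[OF circ_grade[OF v a] b]
      Q(2)[OF v]
    note s = g[THEN part_subset_sum] part_subset_sum[OF a] part_subset_sum[OF b] part_subset_sum[OF v]
    \<comment> \<open>Left symmetry inside the argument of \<open>q\<close> brings \<open>v\<close> to the front, where \<open>q\<close> can be pulled out.\<close>
    have "q ((a \<bullet> v) \<bullet> b - a \<bullet> (v \<bullet> b)) = q (koszul i j ((v \<bullet> a) \<bullet> b - v \<bullet> (a \<bullet> b)))"
      by (simp add: left_symmetric[OF a v b])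
    also have "\<dots> = koszul i j (koszul k m (koszul k i ((q v \<bullet> a) \<bullet> b)) - koszul k (i + m) (q v \<bullet> (a
        \<bullet> b)))"
      using s by (simp add: koszul_def L diff_in_sum Q(3)[OF circ_grade[OF v a] b] Q(3)[OF v a]
          Q(3)[OF v circ_grade[OF a b]]
        circ_uminus circ_in del: add_bit_eq_xor)
    finally have 1: "q (a \<bullet> (v \<bullet> b)) = q ((a \<bullet> v) \<bullet> b)
        - koszul i j (koszul k m (koszul k i ((q v \<bullet> a) \<bullet> b)) - koszul k (i + m) (q v \<bullet> (a \<bullet> b)))"
      using s by (simp add: L algebra_simps del: add_bit_eq_xor)
    have 2: "a \<bullet> (q v \<bullet> b) = (a \<bullet> q v) \<bullet> b - koszul i (k + j) ((q v \<bullet> a) \<bullet> b - q v \<bullet> (a \<bullet> b))"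
      using left_symmetric[OF a Q(2)[OF v] b] by (simp add: algebra_simps)
    have 3: "q ((a \<bullet> v) \<bullet> b) = koszul k m (q (a \<bullet> v) \<bullet> b)" by (rule Q(3)[OF circ_grade[OF a v] b])
    have 4: "a \<bullet> koszul k m (q v \<bullet> b) = koszul k m (a \<bullet> (q v \<bullet> b))"
      using s by (simp add: koszul_def circ_uminus circ_in)
    have 5: "koszul i j (a \<bullet> q v - q (a \<bullet> v)) \<bullet> b = koszul i j ((a \<bullet> q v) \<bullet> b - q (a \<bullet> v) \<bullet> b)"
      using s by (simp add: koszul_def circ_uminus circ_diff circ_in L)
    show ?thesis
      unfolding endo_left_homogeneous[OF Q(1) a v] endo_left_homogeneous[OF Q(1) a circ_grade[OF v b]]
        Q(3)[OF v b] 4 5 1 2 3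
      by (cases i; cases j; cases k; cases m) (simp_all add: koszul_def)
  qed
  ultimately show ?thesis
    by (intro right_endosI endo_left_linear[OF part_subset_sum[OF a] Q(1)])
qed

lemma endo_right_in:
  assumes a: "a \<in> V i" and q: "q \<in> right_endos k"
  shows "endo_right a q \<in> right_endos (i + k)"
proof -
  note Q = right_endosD[OF q] and L = linear_mapsD[OF right_endosD(1)[OF q]]
  have "endo_right a q v \<in> V (i + k + j)" if v: "v \<in> V j" for v j
    using Q(2)[OF circ_grade[OF v a]] unfolding endo_right_homogeneous[OF v] by (metis add.assoc
        add.commute)
  moreover have "endo_right a q (v \<bullet> b) = koszul (i + k) m (endo_right a q v \<bullet> b)" if v: "v \<in> V j"
      and b: "b \<in> V m" for v b j m
  proof -
    have "endo_right a q (v \<bullet> b) = q (koszul m i ((v \<bullet> a) \<bullet> b))"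
      unfolding endo_right_homogeneous[OF circ_grade[OF v b]] right_commutative[OF v b a] ..
    also have "\<dots> = koszul m i (q ((v \<bullet> a) \<bullet> b))"
      using part_subset_sum[OF circ_grade[OF circ_grade[OF v a] b]] by (simp add: koszul_def L)
    also have "\<dots> = koszul (i + k) m (endo_right a q v \<bullet> b)"
      unfolding endo_right_homogeneous[OF v] Q(3)[OF circ_grade[OF v a] b] koszul_plus_left
          koszul_commute[of m i] ..
    finally show ?thesis .
  qed
  ultimately show ?thesis
    by (intro right_endosI endo_right_linear[OF part_subset_sum[OF a] Q(1)])
qed

lemma endo_left_bilinear:
  assumes a: "a \<in> graded_sum V" and p: "p \<in> linear_maps"
  shows "b \<in> graded_sum V \<Longrightarrow> endo_left (a + b) p = endo_left a p + endo_left b p"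
    and "q \<in> linear_maps \<Longrightarrow> endo_left a (p + q) = endo_left a p + endo_left a q"
    and "endo_left (scale c a) p = scale_map c (endo_left a p)"
    and "endo_left a (scale_map c p) = scale_map c (endo_left a p)"
proof -
  note simps = linear_mapsD[OF p] a endo_left_def UNIV_bit_eq component_add component_scale
      scale_map_apply koszul_def
    sum_simps circ_add_left circ_add_right circ_scale_left circ_scale_right scale_right_distrib
    scale_right_diff_distrib
  show "endo_left (a + b) p = endo_left a p + endo_left b p" if "b \<in> graded_sum V"
    using that by (simp add: fun_eq_iff simps)
  show "endo_left a (p + q) = endo_left a p + endo_left a q" if "q \<in> linear_maps"
    using that by (simp add: fun_eq_iff simps linear_mapsD[OF that])
  show "endo_left (scale c a) p = scale_map c (endo_left a p)"
    by (simp add: fun_eq_iff simps)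
  show "endo_left a (scale_map c p) = scale_map c (endo_left a p)"
    by (simp add: fun_eq_iff simps)
qed

lemma endo_right_bilinear:
  assumes a: "a \<in> graded_sum V" and p: "p \<in> linear_maps"
  shows "b \<in> graded_sum V \<Longrightarrow> endo_right (a + b) p = endo_right a p + endo_right b p"
    and "q \<in> linear_maps \<Longrightarrow> endo_right a (p + q) = endo_right a p + endo_right a q"
    and "endo_right (scale c a) p = scale_map c (endo_right a p)"
    and "endo_right a (scale_map c p) = scale_map c (endo_right a p)"
proof -
  note simps = linear_mapsD[OF p] a endo_right_def scale_map_apply sum_simps circ_add_right
      circ_scale_right
  show "endo_right (a + b) p = endo_right a p + endo_right b p" if "b \<in> graded_sum V"
    using that by (simp add: fun_eq_iff simps)
  show "endo_right a (p + q) = endo_right a p + endo_right a q" if "q \<in> linear_maps"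
    using that by (simp add: fun_eq_iff simps linear_mapsD[OF that])
  show "endo_right (scale c a) p = scale_map c (endo_right a p)"
    by (simp add: fun_eq_iff simps)
  show "endo_right a (scale_map c p) = scale_map c (endo_right a p)"
    by (simp add: fun_eq_iff simps)
qed

lemma ext_left_bilinear: "even_bilinear scale V ext_scale ext_module ext_scale ext_module ext_left"
  unfolding even_bilinear_def
proof (intro conjI allI ballI)
  fix i j a p assume a: "a \<in> V i" and p: "p \<in> ext_module j"
  obtain q w where p: "p = (q, w)" "q \<in> right_endos j" "w \<in> V j" using p unfolding ext_module_def by blast
  have "a \<bullet> w \<in> V (i + j)" "q a \<in> V (i + j)" "endo_left a q \<in> right_endos (i + j)"
    using circ_grade[OF a p(3)] right_endosD(2)[OF p(2) a] endo_left_in[OF a p(2)] unfolding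
        add.commute[of j i] .
  then show "ext_left a p \<in> ext_module (i + j)"
    by (simp add: p(1) ext_left_def ext_module_def subspace_add[OF subspace_part] del: add_bit_eq_xor)
qed (use ext_module_sumD linear_mapsD in \<open>auto simp: ext_left_def ext_scale_def endo_left_bilinear
    circ_add_left circ_add_right circ_scale_left circ_scale_right
     scale_right_distrib scale_map_apply add_in_sum algebra_simps\<close>)

lemma ext_right_bilinear: "even_bilinear scale V ext_scale ext_module ext_scale ext_module ext_right"
  unfolding even_bilinear_def
proof (intro conjI allI ballI)
  fix i j a p assume a: "a \<in> V i" and p: "p \<in> ext_module j"
  obtain q w where p: "p = (q, w)" "q \<in> right_endos j" "w \<in> V j" using p unfolding ext_module_def by blast
  show "ext_right a p \<in> ext_module (i + j)"
    using endo_right_in[OF a p(2)] even_bilinearD(5)[OF opp_bilinear a p(3)]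
    by (simp add: p(1) ext_right_def ext_module_def del: add_bit_eq_xor)
qed (use ext_module_sumD even_bilinearD[OF opp_bilinear] in \<open>auto simp: ext_right_def ext_scale_def
    endo_right_bilinear\<close>)

end

context novikov_superalgebra
begin

text \<open>
  The components in \<open>V\<close> reduce to the relations of the regular bimodule and the terms \<open>q(a)\<close>; the
  components in \<open>Q\<close> are compared on homogeneous \<open>v\<close>.
\<close>

theorem bimodule_ext_module: "novikov_bimodule scale V circ ext_scale ext_module ext_left ext_right"
proof (intro novikov_bimodule.intro novikov_superalgebra_axioms superspace_ext_module
    novikov_bimodule_axioms.intro
    ext_left_bilinear ext_right_bilinear)
  interpret R: novikov_bimodule scale V circ scale V circ opp by (rule regular_bimodule)
  fix a b i j u k assume a: "a \<in> V i" and b: "b \<in> V j" and "u \<in> ext_module k"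
  then obtain q w where u: "u = (q, w)" and q: "q \<in> right_endos k" and w: "w \<in> V k"
    unfolding ext_module_def by blast
  note Q = right_endosD[OF q] and L = linear_mapsD[OF right_endosD(1)[OF q]]
  have ab: "a \<bullet> b \<in> V (i + j)" "b \<bullet> a \<in> V (i + j)" using circ_grade[OF a b] circ_grade[OF b a]
      unfolding add.commute[of j i] .
  note S = part_subset_sum
  note s = S[OF a] S[OF b] S[OF w] S[OF ab(1)] S[OF ab(2)] Q(2)[OF a, THEN S] Q(2)[OF b, THEN S]
  note lin = linear_maps_closed endo_left_linear endo_right_linear Q(1) s
  note opp_simps = even_bilinearD(1,2)[OF opp_bilinear]
    even_bilinear_minus[OF opp_bilinear superspace_axioms superspace_axioms]
  have left_at: "endo_left x p v = koszul i' m (x \<bullet> p v - p (x \<bullet> v))" if "x \<in> V i'" "v \<in> V m" "p \<in>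
      linear_maps" for x p v i' m
    by (rule endo_left_homogeneous) (use that in auto)
  have v_facts:
    "a \<bullet> v \<in> graded_sum V" "b \<bullet> v \<in> graded_sum V" "v \<bullet> a \<in> graded_sum V" "v \<bullet> b \<in> graded_sum V"
    "q v \<in> graded_sum V" "q (a \<bullet> v) \<in> graded_sum V"  "q (b \<bullet> v) \<in> graded_sum V"
    "a \<bullet> q v \<in> graded_sum V" "b \<bullet> q v \<in> graded_sum V"
    "a \<bullet> (b \<bullet> v) \<in> graded_sum V" "b \<bullet> (a \<bullet> v) \<in> graded_sum V" "a \<bullet> b \<bullet> v \<in> graded_sum V" "b \<bullet> a \<bullet> v
        \<in> graded_sum V"
    "v \<in> graded_sum V"
    if "v \<in> V m" for v m
    using s S[OF that] by (simp_all add: circ_in L)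
  have k1: "x \<bullet> koszul p r y = koszul p r (x \<bullet> y)" "koszul p r x \<bullet> y = koszul p r (x \<bullet> y)"
    if "x \<in> graded_sum V" "y \<in> graded_sum V" for x y p r
    using that by (simp_all add: koszul_def circ_uminus)
  have kq: "q (koszul p r y) = koszul p r (q y)" if "y \<in> graded_sum V" for y p r
    using that by (simp add: koszul_def L)

  show "ext_right b (ext_right a u) = koszul i j (ext_right a (ext_right b u))"
  proof -
    have "endo_right b (endo_right a q) = koszul i j (endo_right a (endo_right b q))"
    proof (rule linear_maps_eqI)
      fix v m assume v: "v \<in> V m"
      note g = circ_grade[OF v a] circ_grade[OF v b]
      show "endo_right b (endo_right a q) v = koszul i j (endo_right a (endo_right b q)) v"
        unfolding koszul_apply endo_right_homogeneous[OF v] endo_right_homogeneous[OF g(1)]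
            endo_right_homogeneous[OF g(2)]
          right_commutative[OF v b a] kq[OF S[OF circ_grade[OF g(1) b]]] koszul_commute[of j i] ..
    qed (intro lin)+
    then show ?thesis
      using R.r_r[OF a b w] by (simp add: u ext_right_def koszul_Pair)
  qed

  show "ext_right b (ext_left a u) = koszul i j (ext_left (a \<bullet> b) u)"
  proof -
    have "endo_right b (endo_left a q) = koszul i j (endo_left (a \<bullet> b) q)"
    proof (rule linear_maps_eqI)
      fix v m assume v: "v \<in> V m"
      have 1: "endo_left a q (v \<bullet> b) = koszul (i + k) j (endo_left a q v \<bullet> b)"
        by (rule right_endosD(3)[OF endo_left_in[OF a q] v b])
      have 2: "q ((a \<bullet> b) \<bullet> v) = koszul j m (koszul k j (q (a \<bullet> v) \<bullet> b))"
        unfolding right_commutative[OF a b v] kq[OF S[OF circ_grade[OF circ_grade[OF a v] b]]]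
          Q(3)[OF circ_grade[OF a v] b] ..
      have 3: "(a \<bullet> b) \<bullet> q v = koszul j (k + m) ((a \<bullet> q v) \<bullet> b)"
        by (rule right_commutative[OF a b Q(2)[OF v]])
      have 4: "koszul i m (a \<bullet> q v - q (a \<bullet> v)) \<bullet> b = koszul i m ((a \<bullet> q v) \<bullet> b - q (a \<bullet> v) \<bullet> b)"
        using v_facts[OF v] s by (simp add: k1 circ_diff diff_in_sum)
      show "endo_right b (endo_left a q) v = koszul i j (endo_left (a \<bullet> b) q) v"
        unfolding koszul_apply endo_right_homogeneous[OF v] left_at[OF ab(1) v Q(1)] 1 left_at[OF a
            v Q(1)] 2 3 4
        by (cases i; cases j; cases k; cases m) (simp_all add: koszul_def)
    qed (intro lin)+
    moreover have "opp b (q a) = koszul i j (q (a \<bullet> b))"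
      unfolding opp_homogeneous[OF b Q(2)[OF a]] Q(3)[OF a b]
      by (simp add: koszul_plus_right koszul_commute[of j] koszul_koszul)
        (cases i; cases j; cases k; simp add: koszul_def)
    ultimately show ?thesis
      using R.r_l[OF a b w] s by (simp add: u ext_right_def ext_left_def koszul_Pair opp_simps
          koszul_add circ_in)
  qed

  show "ext_left a (ext_left b u) - ext_left (a \<bullet> b) u = koszul i j (ext_left b (ext_left a u) -
      ext_left (b \<bullet> a) u)"
  proof -
    have "endo_left a (endo_left b q) - endo_left (a \<bullet> b) q = koszul i j (endo_left b (endo_left a
        q) - endo_left (b \<bullet> a) q)"
    proof (rule linear_maps_eqI)
      fix v m assume v: "v \<in> V m"
      note vf = v_facts[OF v]
      have 1: "a \<bullet> (b \<bullet> q v) = (a \<bullet> b) \<bullet> q v - koszul i j ((b \<bullet> a) \<bullet> q v - b \<bullet> (a \<bullet> q v))"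
        unfolding left_symmetric[OF a b Q(2)[OF v], symmetric] by simp
      have "a \<bullet> (b \<bullet> v) = (a \<bullet> b) \<bullet> v - koszul i j ((b \<bullet> a) \<bullet> v - b \<bullet> (a \<bullet> v))"
        unfolding left_symmetric[OF a b v, symmetric] by simp
      then have 2: "q (a \<bullet> (b \<bullet> v)) = q ((a \<bullet> b) \<bullet> v) - koszul i j (q ((b \<bullet> a) \<bullet> v) - q (b \<bullet> (a \<bullet> v)))"
        using vf by (simp add: koszul_def L diff_in_sum neg_in_sum)
      show "(endo_left a (endo_left b q) - endo_left (a \<bullet> b) q) v = koszul i j (endo_left b
          (endo_left a q) - endo_left (b \<bullet> a) q) v"
        unfolding koszul_apply minus_apply left_at[OF a v endo_left_linear[OF s(2) Q(1)]] left_at[OF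
            b v endo_left_linear[OF s(1) Q(1)]]
          left_at[OF a v Q(1)] left_at[OF b v Q(1)] left_at[OF ab(1) v Q(1)] left_at[OF ab(2) v Q(1)]
          left_at[OF a circ_grade[OF b v] Q(1)] left_at[OF b circ_grade[OF a v] Q(1)]
        using vf s by (simp add: k1 circ_diff diff_in_sum 1 2 del: add_bit_eq_xor)
          (cases i; cases j; cases m; simp add: koszul_def)
    qed (intro lin)+
    moreover have "endo_left a q b = koszul i j (a \<bullet> q b - q (a \<bullet> b))" "endo_left b q a = koszul j i
        (b \<bullet> q a - q (b \<bullet> a))"
      by (intro left_at a b Q(1))+
    ultimately show ?thesis
      using R.l_l[OF a b w] s by (simp add: u ext_left_def koszul_Pair koszul_add circ_add_right
          circ_in koszul_commute[of j i])
        (cases i; cases j; simp add: koszul_def algebra_simps)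
  qed

  show "ext_left a (ext_right b u) - ext_left (a \<bullet> b) u = ext_right (a \<bullet> b) u - ext_right a
      (ext_right b u)"
  proof -
    have "endo_left a (endo_right b q) - endo_left (a \<bullet> b) q = endo_right (a \<bullet> b) q - endo_right a
        (endo_right b q)"
    proof (rule linear_maps_eqI)
      fix v m assume v: "v \<in> V m"
      note vf = v_facts[OF v]
      have 1: "q ((a \<bullet> b) \<bullet> v) = koszul j m (q ((a \<bullet> v) \<bullet> b))"
        unfolding right_commutative[OF a b v] using vf s by (simp add: kq circ_in)
      have 2: "(a \<bullet> b) \<bullet> q v = koszul j (k + m) ((a \<bullet> q v) \<bullet> b)"
        by (rule right_commutative[OF a b Q(2)[OF v]])
      have 3: "q ((v \<bullet> a) \<bullet> b) = koszul k j (koszul k i ((q v \<bullet> a) \<bullet> b))"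
        unfolding Q(3)[OF circ_grade[OF v a] b] Q(3)[OF v a] using vf s by (simp add: k1 circ_in)
      have 4: "a \<bullet> (q v \<bullet> b) = (a \<bullet> q v) \<bullet> b - koszul i (k + m) ((q v \<bullet> a) \<bullet> b - q v \<bullet> (a \<bullet> b))"
        unfolding left_symmetric[OF a Q(2)[OF v] b, symmetric] by simp
      have 5: "a \<bullet> koszul k j (q v \<bullet> b) = koszul k j (a \<bullet> (q v \<bullet> b))"
        using vf s by (simp add: k1 circ_in)
      show "(endo_left a (endo_right b q) - endo_left (a \<bullet> b) q) v = (endo_right (a \<bullet> b) q -
          endo_right a (endo_right b q)) v"
        unfolding minus_apply endo_right_homogeneous[OF v] endo_right_homogeneous[OF circ_grade[OF v a]]
          left_at[OF a v endo_right_linear[OF s(2) Q(1)]] left_at[OF ab(1) v Q(1)]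
              endo_right_homogeneous[OF circ_grade[OF a v]]
          1 2 3 Q(3)[OF v b] Q(3)[OF v ab(1)] 5 4
        by (cases i; cases j; cases k; cases m; simp add: koszul_def)
    qed (intro lin)+
    then show ?thesis
      using R.l_r[OF a b w] s by (simp add: u ext_left_def ext_right_def endo_right_def koszul_Pair
          koszul_add circ_in)
  qed
qed

end

section \<open>Coordinates\<close>

theorem (in novikov_bimodule) transport:
  fixes scaleX :: "'k \<Rightarrow> 'x::ab_group_add \<Rightarrow> 'x" and \<phi> :: "'u \<Rightarrow> 'x"
  assumes X: "vector_space scaleX"
    and add: "\<And>u w. \<lbrakk>u \<in> graded_sum U; w \<in> graded_sum U\<rbrakk> \<Longrightarrow> \<phi> (u + w) = \<phi> u + \<phi> w"
    and sc: "\<And>c u. u \<in> graded_sum U \<Longrightarrow> \<phi> (scaleU c u) = scaleX c (\<phi> u)"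
    and inj: "\<And>u. u \<in> graded_sum U \<Longrightarrow> \<phi> u = 0 \<Longrightarrow> u = 0"
  defines "\<psi> \<equiv> inv_into (graded_sum U) \<phi>"
  shows "novikov_bimodule scale V circ scaleX (\<lambda>i. \<phi> ` U i) (\<lambda>a x. \<phi> (l a (\<psi> x))) (\<lambda>a x. \<phi> (r a (\<psi> x)))"
    and "u \<in> graded_sum U \<Longrightarrow> \<psi> (\<phi> u) = u"
    and "graded_sum (\<lambda>i. \<phi> ` U i) = \<phi> ` graded_sum U"
proof -
  interpret X: vector_space scaleX by (rule X)
  have phi0: "\<phi> 0 = 0" using sc[OF U.zero_in_sum, of 0] by simp
  have neg: "\<phi> (- u) = - \<phi> u" if "u \<in> graded_sum U" for u
    using sc[OF that, of "-1"] by simp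
  have diff: "\<phi> (u - w) = \<phi> u - \<phi> w" if "u \<in> graded_sum U" "w \<in> graded_sum U" for u w
    using add[OF that(1) U.neg_in_sum[OF that(2)]] neg[OF that(2)] by simp
  have "inj_on \<phi> (graded_sum U)"
  proof (rule inj_onI)
    fix u w assume uw: "u \<in> graded_sum U" "w \<in> graded_sum U" "\<phi> u = \<phi> w"
    then have "u - w = 0" by (intro inj U.diff_in_sum) (simp_all add: diff)
    then show "u = w" by simp
  qed
  then have psi: "\<psi> (\<phi> u) = u" if "u \<in> graded_sum U" for u
    using that by (simp add: \<psi>_def)
  then show "u \<in> graded_sum U \<Longrightarrow> \<psi> (\<phi> u) = u" by blast
  have kos: "\<phi> (koszul i j u) = koszul i j (\<phi> u)" "koszul i j u \<in> graded_sum U" if "u \<in> graded_sum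
      U" for i j u
    using that by (simp_all add: koszul_def neg U.neg_in_sum)
  show gs: "graded_sum (\<lambda>i. \<phi> ` U i) = \<phi> ` graded_sum U"
  proof (intro equalityI subsetI)
    fix x assume "x \<in> graded_sum (\<lambda>i. \<phi> ` U i)"
    then obtain a b where "a \<in> U 0" "b \<in> U 1" "x = \<phi> a + \<phi> b" unfolding graded_sum_def by blast
    then have "x = \<phi> (a + b)" "a + b \<in> graded_sum U"
      using add[OF U.part_subset_sum U.part_subset_sum] U.add_in_sum[OF U.part_subset_sum
          U.part_subset_sum] by auto
    then show "x \<in> \<phi> ` graded_sum U" by blast
  next
    fix x assume "x \<in> \<phi> ` graded_sum U"
    then obtain a b where ab: "a \<in> U 0" "b \<in> U 1" "x = \<phi> (a + b)" unfolding graded_sum_def by blast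
    then have "x = \<phi> a + \<phi> b" using add[OF U.part_subset_sum U.part_subset_sum] by auto
    then show "x \<in> graded_sum (\<lambda>i. \<phi> ` U i)" using ab unfolding graded_sum_def by blast
  qed
  have ss: "superspace scaleX (\<lambda>i. \<phi> ` U i)"
  proof unfold_locales
    show "X.subspace (\<phi> ` U i)" for i
      unfolding X.subspace_def
    proof (intro conjI ballI allI)
      show "0 \<in> \<phi> ` U i" using phi0 U.zero_in by force
      show "x + y \<in> \<phi> ` U i" if xy: "x \<in> \<phi> ` U i" "y \<in> \<phi> ` U i" for x y
      proof -
        obtain u w where "u \<in> U i" "w \<in> U i" "x = \<phi> u" "y = \<phi> w" using xy by blast
        then show ?thesis
          using add[OF U.part_subset_sum U.part_subset_sum, of u i w i] U.subspace_add[OF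
              U.subspace_part, of u i w]
          by (metis imageI)
      qed
      show "scaleX c x \<in> \<phi> ` U i" if x: "x \<in> \<phi> ` U i" for c x
      proof -
        obtain u where "u \<in> U i" "x = \<phi> u" using x by blast
        then show ?thesis
          using sc[OF U.part_subset_sum, of u i c] U.subspace_scale[OF U.subspace_part, of u i c]
          by (metis imageI)
      qed
    qed
    show "\<phi> ` U 0 \<inter> \<phi> ` U 1 = {0}"
    proof (intro equalityI subsetI)
      fix x assume "x \<in> \<phi> ` U 0 \<inter> \<phi> ` U 1"
      then obtain u w where u: "u \<in> U 0" "w \<in> U 1" "x = \<phi> u" "x = \<phi> w" by blast
      then have "u = w" using psi[OF U.part_subset_sum] by metis
      then have "u \<in> U 0 \<inter> U 1" using u by simp
      then show "x \<in> {0}" using U.direct phi0 u by auto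
    qed (use phi0 U.zero_in in force)
  qed
  have bil: "even_bilinear scale V scaleX (\<lambda>i. \<phi> ` U i) scaleX (\<lambda>i. \<phi> ` U i) (\<lambda>a x. \<phi> (f a (\<psi> x)))"
    if f: "even_bilinear scale V scaleU U scaleU U f" for f
  proof -
    note F = even_bilinearD[OF f]
      even_bilinear_in_sum[OF f superspace_axioms U.superspace_axioms U.superspace_axioms]
    show ?thesis
      unfolding even_bilinear_def gs
    proof (intro conjI allI ballI)
      fix i j a x assume a: "a \<in> V i" "x \<in> \<phi> ` U j"
      then obtain u where u: "x = \<phi> u" "u \<in> U j" by blast
      show "\<phi> (f a (\<psi> x)) \<in> \<phi> ` U (i + j)"
        using F(5)[OF a(1) u(2)] unfolding u(1) psi[OF U.part_subset_sum[OF u(2)]] by (rule imageI)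
    qed (auto simp: psi F(1-4,6) add sc simp flip: add sc simp: U.add_in_sum U.scale_in_sum)
  qed
  show "novikov_bimodule scale V circ scaleX (\<lambda>i. \<phi> ` U i) (\<lambda>a x. \<phi> (l a (\<psi> x))) (\<lambda>a x. \<phi> (r a (\<psi> x)))"
  proof (intro novikov_bimodule.intro novikov_superalgebra_axioms ss novikov_bimodule_axioms.intro
      bil l_bilinear r_bilinear)
    fix a b x i j k assume a: "a \<in> V i" and b: "b \<in> V j" and x: "x \<in> \<phi> ` U k"
    then obtain u where u: "x = \<phi> u" "u \<in> U k" by blast
    note s = part_subset_sum[OF a] part_subset_sum[OF b] U.part_subset_sum[OF u(2)]
      part_subset_sum[OF circ_grade[OF a b]] part_subset_sum[OF circ_grade[OF b a]]
    show "\<phi> (r b (\<psi> (\<phi> (r a (\<psi> x))))) = koszul i j (\<phi> (r a (\<psi> (\<phi> (r b (\<psi> x))))))"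
      using r_r[OF a b u(2)] s by (simp add: u(1) psi r_in kos)
    show "\<phi> (r b (\<psi> (\<phi> (l a (\<psi> x))))) = koszul i j (\<phi> (l (a \<bullet> b) (\<psi> x)))"
      using r_l[OF a b u(2)] s by (simp add: u(1) psi r_in l_in kos)
    have "\<phi> (l a (l b u) - l (a \<bullet> b) u) = \<phi> (koszul i j (l b (l a u) - l (b \<bullet> a) u))"
      by (simp only: l_l[OF a b u(2)])
    then show "\<phi> (l a (\<psi> (\<phi> (l b (\<psi> x))))) - \<phi> (l (a \<bullet> b) (\<psi> x)) =
       koszul i j (\<phi> (l b (\<psi> (\<phi> (l a (\<psi> x))))) - \<phi> (l (b \<bullet> a) (\<psi> x)))"
      using s by (simp add: u(1) psi r_in l_in kos diff U.diff_in_sum)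
    have "\<phi> (l a (r b u) - l (a \<bullet> b) u) = \<phi> (r (a \<bullet> b) u - r a (r b u))"
      by (simp only: l_r[OF a b u(2)])
    then show "\<phi> (l a (\<psi> (\<phi> (r b (\<psi> x))))) - \<phi> (l (a \<bullet> b) (\<psi> x)) =
       \<phi> (r (a \<bullet> b) (\<psi> x)) - \<phi> (r a (\<psi> (\<phi> (r b (\<psi> x)))))"
      using s by (simp add: u(1) psi r_in l_in kos diff U.diff_in_sum)
  qed
qed

lemma vector_space_seq_scale: "vector_space (seq_scale :: 'k::field \<Rightarrow> (nat \<Rightarrow> 'k) \<Rightarrow> nat \<Rightarrow> 'k)"
  by unfold_locales (auto simp: seq_scale_def fun_eq_iff algebra_simps)

lemma (in vector_space) subspace_finite_span:
  assumes S: "subspace S" and E: "finite E" "S \<subseteq> span E"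
  shows "\<exists>B. finite B \<and> span B = S"
proof -
  obtain B where B: "B \<subseteq> S" "independent B" "S \<subseteq> span B"
    using maximal_independent_subset[of S] by blast
  then have "finite B" using independent_span_bound[OF E(1) B(2)] E(2) by blast
  moreover have "span B = S" using B span_minimal[OF B(1) S] by blast
  ultimately show ?thesis by blast
qed

lemma finitely_supported_fin_dim:
  fixes S :: "(nat \<Rightarrow> 'k::field) set"
  assumes S: "module.subspace seq_scale S" and N: "finite N" "\<And>u k. u \<in> S \<Longrightarrow> k \<notin> N \<Longrightarrow> u k = 0"
  shows "\<exists>B. finite B \<and> module.span seq_scale B = S"
proof -
  interpret vector_space "seq_scale :: 'k \<Rightarrow> _" by (rule vector_space_seq_scale)
  define e :: "nat \<Rightarrow> nat \<Rightarrow> 'k" where "e n = (\<lambda>k. if k = n then 1 else 0)" for n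
  have "u \<in> span (e ` N)" if "u \<in> S" for u
  proof -
    have "u k = (\<Sum>n\<in>N. seq_scale (u n) (e n)) k" for k
    proof -
      have "(\<Sum>n\<in>M. seq_scale (u n) (e n)) k = (\<Sum>n\<in>M. u n * (if k = n then 1 else 0))" if "finite M" for M
        using that by (induction M) (auto simp: seq_scale_def e_def)
      from this[OF N(1)] show ?thesis
        using N that by (cases "k \<in> N") (simp_all add: if_distrib cong: if_cong)
    qed
    then have "u = (\<Sum>n\<in>N. seq_scale (u n) (e n))" by (rule ext)
    then show ?thesis by (metis (no_types, lifting) span_sum span_scale span_base imageI)
  qed
  then show ?thesis
    using subspace_finite_span[OF S, of "e ` N"] N(1) by blast
qed

context novikov_superalgebra
begin

text \<open>
  That the \<open>e k\<close> span is stated for subspaces, because it is applied to the kernel of a linear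
  map.
\<close>

lemma coordinates:
  assumes fin_dim
  obtains n :: nat and e :: "nat \<Rightarrow> 'v" and coord :: "'v \<Rightarrow> nat \<Rightarrow> 'k"
  where "\<And>k. k < n \<Longrightarrow> e k \<in> graded_sum V"
    and "\<And>S. subspace S \<Longrightarrow> (\<And>k. k < n \<Longrightarrow> e k \<in> S) \<Longrightarrow> graded_sum V \<subseteq> S"
    and "\<And>v w. \<lbrakk>v \<in> graded_sum V; w \<in> graded_sum V\<rbrakk> \<Longrightarrow> coord (v + w) = coord v + coord w"
    and "\<And>c v. v \<in> graded_sum V \<Longrightarrow> coord (scale c v) = seq_scale c (coord v)"
    and "\<And>v. v \<in> graded_sum V \<Longrightarrow> coord v = 0 \<Longrightarrow> v = 0"
    and "\<And>v k. k \<ge> n \<Longrightarrow> coord v k = 0"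
proof -
  obtain B0 where B0: "finite B0" "span B0 = graded_sum V" using assms unfolding fin_dim_def by blast
  obtain B where B: "B \<subseteq> B0" "independent B" "B0 \<subseteq> span B"
    using maximal_independent_subset by blast
  have fB: "finite B" using B(1) B0(1) finite_subset by blast
  have sB: "span B = graded_sum V"
    using span_mono[OF B(1)] span_minimal[OF B(3) subspace_span] B0(2) by blast
  obtain e :: "nat \<Rightarrow> 'v" where e: "bij_betw e {0..<card B} B"
    using ex_bij_betw_nat_finite[OF fB] by blast
  define coord where "coord v k = (if k < card B then representation B v (e k) else 0)" for v k
  have eB: "e ` {0..<card B} = B" using e by (rule bij_betw_imp_surj_on)
  show ?thesis
  proof (rule that[of "card B" e coord])
    show "e k \<in> graded_sum V" if "k < card B" for k
      using that eB sB span_base by (metis atLeastLessThan_iff imageI zero_le)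
    show "graded_sum V \<subseteq> S" if "subspace S" "\<And>k. k < card B \<Longrightarrow> e k \<in> S" for S
    proof -
      have "e ` {0..<card B} \<subseteq> S" using that(2) by auto
      then have "B \<subseteq> S" using eB by simp
      then show ?thesis using span_minimal[OF _ that(1)] sB by blast
    qed
    show "coord (v + w) = coord v + coord w" if "v \<in> graded_sum V" "w \<in> graded_sum V" for v w
      using that by (auto simp: coord_def fun_eq_iff representation_add[OF B(2)] sB)
    show "coord (scale c v) = seq_scale c (coord v)" if "v \<in> graded_sum V" for c v
      using that by (auto simp: coord_def fun_eq_iff seq_scale_def representation_scale[OF B(2)] sB)
    show "v = 0" if v: "v \<in> graded_sum V" and 0: "coord v = 0" for v
    proof -
      have "representation B v b = 0" if "b \<in> B" for b
      proof -
        have "b \<in> e ` {0..<card B}" using that eB by simp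
        then obtain k where "k < card B" "b = e k" by auto
        then show ?thesis using fun_cong[OF 0, of k] by (simp add: coord_def)
      qed
      then have "(\<Sum>b\<in>B. scale (representation B v b) b) = 0" by simp
      then show ?thesis
        using sum_representation_eq[OF B(2) _ fB order_refl, of v] v sB by simp
    qed
    show "coord v k = 0" if "k \<ge> card B" for v k
      using that by (simp add: coord_def)
  qed
qed

text \<open>
  The element \<open>x\<close> of the extended bimodule: \<open>q = 1\<close> corresponds to the identity map.
\<close>

lemma identity_in: "((\<lambda>v. if v \<in> graded_sum V then v else 0), 0) \<in> ext_module 0"
  using zero_in
  by (auto simp: ext_module_def intro!: right_endosI)
    (auto simp: linear_maps_def add_in_sum scale_in_sum part_subset_sum koszul_def circ_in circ_zero)

section \<open>Finite faithful representations\<close>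

theorem finite_faithful_representation:
  assumes fin_dim
  shows "has_finite_faithful_representation (poly_scale scale) (poly_grade V) (pCons 0)
    (quadratic_bracket V circ comm)"
proof -
  obtain n e and coord :: "'v \<Rightarrow> nat \<Rightarrow> 'k" where e: "\<And>k. k < n \<Longrightarrow> e k \<in> graded_sum V"
    and gen: "\<And>S. subspace S \<Longrightarrow> (\<And>k. k < n \<Longrightarrow> e k \<in> S) \<Longrightarrow> graded_sum V \<subseteq> S"
    and coord: "\<And>v w. \<lbrakk>v \<in> graded_sum V; w \<in> graded_sum V\<rbrakk> \<Longrightarrow> coord (v + w) = coord v + coord w"
     "\<And>c v. v \<in> graded_sum V \<Longrightarrow> coord (scale c v) = seq_scale c (coord v)"
     "\<And>v. v \<in> graded_sum V \<Longrightarrow> coord v = 0 \<Longrightarrow> v = 0"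
     "\<And>v k. k \<ge> n \<Longrightarrow> coord v k = 0"
    using coordinates[OF assms] by blast
  interpret B: novikov_bimodule scale V circ ext_scale ext_module ext_left ext_right by (rule
      bimodule_ext_module)
  \<comment> \<open>The coordinates of \<open>(q, w)\<close> are those of \<open>q (e 0)\<close>, ..., \<open>q (e (n - 1))\<close> and \<open>w\<close>, indexed by pairs \<open>(i, j)\<close>.\<close>
  define entry :: "('v \<Rightarrow> 'v) \<times> 'v \<Rightarrow> nat \<Rightarrow> 'v"
    where "entry p i = (if i < n then fst p (e i) else if i = n then snd p else 0)" for p i
  define \<phi> :: "('v \<Rightarrow> 'v) \<times> 'v \<Rightarrow> nat \<Rightarrow> 'k"
    where "\<phi> p = (\<lambda>k. case prod_decode k of (i, j) \<Rightarrow> coord (entry p i) j)" for p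
  define u0 :: "('v \<Rightarrow> 'v) \<times> 'v" where "u0 = ((\<lambda>v. if v \<in> graded_sum V then v else 0), 0)"
  define \<psi> where "\<psi> = inv_into (graded_sum ext_module) \<phi>"
  have coord0: "coord 0 = 0" using coord(2)[OF zero_in_sum, of 0] by (auto simp: seq_scale_def fun_eq_iff)
  have entry_in: "entry p i \<in> graded_sum V" if "p \<in> graded_sum ext_module" for p i
    using ext_module_sumD[OF that] linear_mapsD e zero_in_sum by (simp add: entry_def)
  have \<phi>_add: "\<phi> (p + q) = \<phi> p + \<phi> q" if "p \<in> graded_sum ext_module" "q \<in> graded_sum ext_module" for p q
  proof -
    have "entry (p + q) i = entry p i + entry q i" for i by (simp add: entry_def)
    then show ?thesis
      using coord(1) entry_in that by (auto simp: \<phi>_def fun_eq_iff split: prod.splits)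
  qed
  have \<phi>_scale: "\<phi> (ext_scale c p) = seq_scale c (\<phi> p)" if "p \<in> graded_sum ext_module" for c p
  proof -
    have "entry (ext_scale c p) i = scale c (entry p i)" for i by (simp add: entry_def ext_scale_def
        scale_map_apply)
    then show ?thesis
      using coord(2) entry_in that by (auto simp: \<phi>_def fun_eq_iff seq_scale_def split: prod.splits)
  qed
  have \<phi>_inj: "p = 0" if p: "p \<in> graded_sum ext_module" and 0: "\<phi> p = 0" for p
  proof -
    note P = ext_module_sumD[OF p]
    have "coord (entry p i) j = 0" for i j
      using fun_cong[OF 0, of "prod_encode (i, j)"] by (simp add: \<phi>_def)
    then have entry: "entry p i = 0" for i
      using coord(3)[OF entry_in[OF p]] by (simp add: fun_eq_iff)
    have sub: "subspace {v \<in> graded_sum V. fst p v = 0}"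
      unfolding subspace_def using linear_mapsD[OF P(1)] by (auto simp: zero_in_sum add_in_sum
          scale_in_sum)
    have "fst p (e k) = 0" if "k < n" for k using entry[of k] that by (simp add: entry_def)
    then have "fst p v = 0" if "v \<in> graded_sum V" for v
      using gen[OF sub] e that by blast
    then have "fst p = 0" using linear_mapsD(4)[OF P(1)] by (auto simp: fun_eq_iff)
    moreover have "snd p = 0" using entry[of n] by (simp add: entry_def)
    ultimately show ?thesis by (simp add: prod_eq_iff)
  qed
  note transport = B.transport[where \<phi> = \<phi>, OF vector_space_seq_scale, folded \<psi>_def]
  have T1: "novikov_bimodule scale V circ seq_scale (\<lambda>i. \<phi> ` ext_module i)
      (\<lambda>a x. \<phi> (ext_left a (\<psi> x))) (\<lambda>a x. \<phi> (ext_right a (\<psi> x)))"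
    by (rule transport(1)) (fact \<phi>_add \<phi>_scale \<phi>_inj)+
  have T2: "\<psi> (\<phi> p) = p" if "p \<in> graded_sum ext_module" for p
    by (rule transport(2)) (fact \<phi>_add \<phi>_scale \<phi>_inj that)+
  have T3: "graded_sum (\<lambda>i. \<phi> ` ext_module i) = \<phi> ` graded_sum ext_module"
    by (rule transport(3)) (fact \<phi>_add \<phi>_scale \<phi>_inj)+
  interpret X: novikov_bimodule scale V circ seq_scale "\<lambda>i. \<phi> ` ext_module i" "\<lambda>a x. \<phi> (ext_left a
      (\<psi> x))" "\<lambda>a x. \<phi> (ext_right a (\<psi> x))"
    by (rule T1)
  have fd: "X.U.fin_dim"
    unfolding X.U.fin_dim_def
  proof (rule finitely_supported_fin_dim)
    show "X.U.subspace (graded_sum (\<lambda>i. \<phi> ` ext_module i))" by (rule X.U.subspace_graded_sum)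
    show "finite (prod_encode ` ({..n} \<times> {..<n}))" by simp
    fix u k assume u: "u \<in> graded_sum (\<lambda>i. \<phi> ` ext_module i)" and k: "k \<notin> prod_encode ` ({..n} \<times> {..<n})"
    obtain i j where ij: "prod_decode k = (i, j)" by force
    then have "k = prod_encode (i, j)" by (metis prod_decode_inverse)
    with k have nij: "n < i \<or> n \<le> j" by force
    have "u \<in> \<phi> ` graded_sum ext_module" using u by (simp only: T3)
    then obtain p where p: "u = \<phi> p" by blast
    have "u k = coord (entry p i) j" by (simp add: p \<phi>_def ij)
    moreover have "entry p i = 0" if "n < i" using that by (simp add: entry_def)
    ultimately show "u k = 0" using nij coord(4)[of j] coord0 by (metis zero_fun_apply)
  qed
  have u0: "u0 \<in> ext_module 0" unfolding u0_def by (rule identity_in)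
  have "a = 0" if a: "a \<in> graded_sum V" and 0: "\<phi> (ext_left a (\<psi> (\<phi> u0))) = 0" for a
  proof -
    have "\<phi> (ext_left a u0) = 0" using 0 T2[OF B.U.part_subset_sum[OF u0]] by simp
    then have "ext_left a u0 = 0" by (rule \<phi>_inj[OF B.l_in[OF a B.U.part_subset_sum[OF u0]]])
    then show ?thesis using a by (simp add: ext_left_def u0_def prod_eq_iff circ_zero)
  qed
  then show ?thesis
    using X.finite_faithful[OF fd imageI[OF u0]]
    unfolding has_finite_faithful_representation_def by blast
qed

end

theorem corollary3:
  fixes scale :: "'k::field_char_0 \<Rightarrow> 'v::ab_group_add \<Rightarrow> 'v"
    and V :: "bit \<Rightarrow> 'v set"
    and circ :: "'v \<Rightarrow> 'v \<Rightarrow> 'v"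
  assumes "novikov_superalgebra scale V circ"
    and "superspace.fin_dim scale V"
  shows "has_finite_faithful_representation (poly_scale scale) (poly_grade V) (pCons 0)
           (quadratic_bracket V circ (super_commutator V circ))"
  by (rule novikov_superalgebra.finite_faithful_representation[OF assms])

end
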